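(* Let $\mathcal{G}$ be an ultragraph and $R$ a unital commutative ring (with $1\ne0$). The representation $\pi:L_R(\mathcal{G})\rightarrow \mathrm{End}_R(\mathbb{P})$ is faithful (i.e. injective) if, and only if, $\mathcal{G}$ satisfies Condition (L).
   Context: An ultragraph is a quadruple $\mathcal{G}=(G^0,\mathcal{G}^1,r,s)$ where $G^0,\mathcal{G}^1$ are countable sets, $s:\mathcal{G}^1\to G^0$ and $r:\mathcal{G}^1\to P(G^0)\setminus\{\emptyset\}$ are maps. $\mathcal{G}^0$ is the smallest subset of $P(G^0)$ containing $\{v\}$ for all $v\in G^0$ and $r(e)$ for all $e\in\mathcal{G}^1$, and closed under finite unions and non-empty finite intersections. A vertex $v$ is a sink if $s^{-1}(v)=\emptyset$; $G^0_s$ is the set of sinks. $L_R(\mathcal{G})$ is the universal (not necessarily unital) $R$-algebra with generators $\{s_e,s_e^*:e\in\mathcal{G}^1\}\cup\{p_A:A\in\mathcal{G}^0\}$ and relations: (1) $p_\emptyset=0$, $p_Ap_B=p_{A\cap B}$, $p_{A\cup B}=p_A+p_B-p_{A\cap B}$ for all $A,B\in\mathcal{G}^0$; (2) $p_{s(e)}s_e=s_ep_{r(e)}=s_e$ and $p_{r(e)}s_e^*=s_e^*p_{s(e)}=s_e^*$ for each $e$; (3) $s_e^*s_f=\delta_{e,f}p_{r(e)}$ for all $e,f$; (4) $p_v=\sum_{s(e)=v}s_es_e^*$ whenever $0<|s^{-1}(v)|<\infty$ (where $p_v=p_{\{v\}}$). A representation on an $R$-module $M$ is an $R$-algebra homomorphism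 $L_R(\mathcal{G})\to \mathrm{End}_R(M)$. A finite path of length $n\ge1$ is a sequence of edges $\alpha=e_1\dots e_n$ with $s(e_{i+1})\in r(e_i)$ for $1\le i\le n-1$; $s(\alpha)=s(e_1)$, $r(\alpha)=r(e_n)$. An infinite path is a sequence $e_1e_2e_3\dots$ of edges with $s(e_{i+1})\in r(e_i)$ for all $i\ge1$, with source $s(e_1)$. $\mathfrak{p}^\infty$ is the set of infinite paths, and $\mathfrak{p}^*=\{(\alpha,v):\alpha \text{ a finite path of length}\ge1,\ v\in r(\alpha)\cap G^0_s\}\cup\{(v,v):v\in G^0_s\}$, with $s(\alpha,v)=s(\alpha)$ and $s(v,v)=v$. A closed path is a finite path $\alpha=\alpha_1\dots\alpha_n$ with $n\ge1$ and $s(\alpha)\in r(\alpha)$. An exit for a closed path $\alpha$ is either an edge $e\in\mathcal{G}^1$ such that there is $i\in\{1,\dots,n\}$ with $s(e)\in r(\alpha_i)$ but $e\neq\alpha_{i+1}$ (indices cyclic: $\alpha_{n+1}=\alpha_1$), or a sink $w$ such that $w\in r(\alpha_i)$ for some $i$. $\mathcal{G}$ satisfies Condition (L) if every closed path in $\mathcal{G}$ has an exit. $\mathbb{P}$ is the free $R$-module with basis $\{b_\alpha:\alpha\in\mathfrak{p}^*\cup\mathfrak{p}^\infty\}$. For a statement $q$, $[q]=1$ if $q$ is true and $0$ otherwise. $\pi:L_R(\mathcal{G})\to \mathrm{End}_R(\mathbb{P})$ is the representation with $\pi(p_A)(b_\alpha)=[s(\alpha)\in A]b_\alpha$, $\pi(s_e)(b_\alpha)=[s(\alpha)\in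 r(e)]b_{e\alpha}$, $\pi(s_e^* )(b_\alpha)=[\alpha_1=e]b_{\alpha_2\alpha_3\dots}$. Here, for $\alpha=(a,v)\in\mathfrak{p}^*$ with $|a|\ge1$, $e\alpha=(ea,v)$, $\alpha_1=a_1$, and $b_{\alpha_2\alpha_3\dots}$ means $b_{(a_2\dots a_{|a|},v)}$ if $|a|\ge2$ and $b_{(v,v)}$ if $|a|=1$; for $\alpha=(v,v)$ with $v\in r(e)$, $e\alpha=(e,v)$; and $\pi(s_e^* )(b_{(v,v)})=0$. *)

theory Defs
  imports
    "HOL-Library.Poly_Mapping"
    "HOL-Library.FuncSet"
    "HOL-Library.Countable_Set"
begin

section \<open>Ultragraphs\<close>

record ('v, 'e) ultragraph_data =
  verts :: "'v set"
  edges :: "'e set"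
  rng :: "'e \<Rightarrow> 'v set"
  src :: "'e \<Rightarrow> 'v"

locale ultragraph =
  fixes G :: "('v, 'e) ultragraph_data"
  assumes countable_verts: "countable (verts G)"
    and countable_edges: "countable (edges G)"
    and src_verts: "e \<in> edges G \<Longrightarrow> src G e \<in> verts G"
    and rng_verts: "e \<in> edges G \<Longrightarrow> rng G e \<subseteq> verts G"
    and rng_nonempty: "e \<in> edges G \<Longrightarrow> rng G e \<noteq> {}"

text \<open>The generalized vertices. The family in the rule for unions may be empty, so the empty set is
  a generalized vertex; the family in the rule for intersections may not.\<close>

inductive_set gen_verts :: "('v, 'e) ultragraph_data \<Rightarrow> 'v set set"
  for G :: "('v, 'e) ultragraph_data" where
  vert: "v \<in> verts G \<Longrightarrow> {v} \<in> gen_verts G"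
| rng: "e \<in> edges G \<Longrightarrow> rng G e \<in> gen_verts G"
| Union: "finite F \<Longrightarrow> \<forall>A\<in>F. A \<in> gen_verts G \<Longrightarrow> \<Union>F \<in> gen_verts G"
| Inter: "finite F \<Longrightarrow> F \<noteq> {} \<Longrightarrow> \<forall>A\<in>F. A \<in> gen_verts G \<Longrightarrow> \<Inter>F \<in> gen_verts G"

definition sinks :: "('v, 'e) ultragraph_data \<Rightarrow> 'v set" where
  "sinks G = {v \<in> verts G. {e \<in> edges G. src G e = v} = {}}"

definition fin_path :: "('v, 'e) ultragraph_data \<Rightarrow> 'e list \<Rightarrow> bool" where
  "fin_path G a \<longleftrightarrow> a \<noteq> [] \<and> set a \<subseteq> edges G \<and>
     (\<forall>i. Suc i < length a \<longrightarrow> src G (a ! Suc i) \<in> rng G (a ! i))"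

definition inf_path :: "('v, 'e) ultragraph_data \<Rightarrow> (nat \<Rightarrow> 'e) \<Rightarrow> bool" where
  "inf_path G p \<longleftrightarrow> (\<forall>i. p i \<in> edges G) \<and> (\<forall>i. src G (p (Suc i)) \<in> rng G (p i))"

definition closed_path :: "('v, 'e) ultragraph_data \<Rightarrow> 'e list \<Rightarrow> bool" where
  "closed_path G a \<longleftrightarrow> fin_path G a \<and> src G (hd a) \<in> rng G (last a)"

definition edge_exit :: "('v, 'e) ultragraph_data \<Rightarrow> 'e list \<Rightarrow> 'e \<Rightarrow> bool" where
  "edge_exit G a e \<longleftrightarrow> e \<in> edges G \<and>
     (\<exists>i < length a. src G e \<in> rng G (a ! i) \<and> e \<noteq> a ! (Suc i mod length a))"

definition sink_exit :: "('v, 'e) ultragraph_data \<Rightarrow> 'e list \<Rightarrow> 'v \<Rightarrow> bool" where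
  "sink_exit G a w \<longleftrightarrow> w \<in> sinks G \<and> (\<exists>i < length a. w \<in> rng G (a ! i))"

definition condition_L :: "('v, 'e) ultragraph_data \<Rightarrow> bool" where
  "condition_L G \<longleftrightarrow>
     (\<forall>a. closed_path G a \<longrightarrow> (\<exists>e. edge_exit G a e) \<or> (\<exists>w. sink_exit G a w))"


section \<open>The Leavitt path algebra of an ultragraph\<close>

datatype 'g word = Word (letters: "'g list")

text \<open>The unital free \<open>'r\<close>-algebra on \<open>'g\<close> is the monoid algebra \<^typ>\<open>'g word \<Rightarrow>\<^sub>0 'r\<close>, with the
  convolution product of \<^theory>\<open>HOL-Library.Poly_Mapping\<close>.\<close>

instantiation word :: (type) monoid_add
begin

definition zero_word :: "'a word" where
  "0 = Word []"

definition plus_word :: "'a word \<Rightarrow> 'a word \<Rightarrow> 'a word" where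
  "u + w = Word (letters u @ letters w)"

instance
  by standard (simp_all add: zero_word_def plus_word_def)

end

definition smul :: "'r::comm_ring_1 \<Rightarrow> ('b \<Rightarrow>\<^sub>0 'r) \<Rightarrow> ('b \<Rightarrow>\<^sub>0 'r)" where
  "smul c x = Poly_Mapping.map ((*) c) x"

datatype ('v, 'e) gen = P "'v set" | S 'e | Sstar 'e

type_synonym ('v, 'e, 'r) free_alg = "('v, 'e) gen word \<Rightarrow>\<^sub>0 'r"

definition gens :: "('v, 'e) ultragraph_data \<Rightarrow> ('v, 'e) gen set" where
  "gens G = P ` gen_verts G \<union> S ` edges G \<union> Sstar ` edges G"

text \<open>The free non-unital algebra on the generators: the empty word is excluded.\<close>

definition free_on :: "('v, 'e) ultragraph_data \<Rightarrow> ('v, 'e, 'r::comm_ring_1) free_alg set" where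
  "free_on G = {x. \<forall>w \<in> Poly_Mapping.keys x. letters w \<noteq> [] \<and> set (letters w) \<subseteq> gens G}"

definition gvar :: "('v, 'e) gen \<Rightarrow> ('v, 'e, 'r::comm_ring_1) free_alg" where
  "gvar g = Poly_Mapping.single (Word [g]) 1"

abbreviation "pv A \<equiv> gvar (P A)"
abbreviation "sv e \<equiv> gvar (S e)"
abbreviation "sv' e \<equiv> gvar (Sstar e)"

text \<open>A relation \<open>x = y\<close> is represented by \<open>x - y\<close>.\<close>

inductive_set leavitt_relations ::
    "('v, 'e) ultragraph_data \<Rightarrow> ('v, 'e, 'r::comm_ring_1) free_alg set"
  for G :: "('v, 'e) ultragraph_data" where
  p_empty: "pv {} \<in> leavitt_relations G"
| p_Int: "A \<in> gen_verts G \<Longrightarrow> B \<in> gen_verts G \<Longrightarrow>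
    pv A * pv B - pv (A \<inter> B) \<in> leavitt_relations G"
| p_Un: "A \<in> gen_verts G \<Longrightarrow> B \<in> gen_verts G \<Longrightarrow>
    pv (A \<union> B) - (pv A + pv B - pv (A \<inter> B)) \<in> leavitt_relations G"
| src_s: "e \<in> edges G \<Longrightarrow> pv {src G e} * sv e - sv e \<in> leavitt_relations G"
| s_rng: "e \<in> edges G \<Longrightarrow> sv e * pv (rng G e) - sv e \<in> leavitt_relations G"
| rng_s': "e \<in> edges G \<Longrightarrow> pv (rng G e) * sv' e - sv' e \<in> leavitt_relations G"
| s'_src: "e \<in> edges G \<Longrightarrow> sv' e * pv {src G e} - sv' e \<in> leavitt_relations G"
| s's: "e \<in> edges G \<Longrightarrow> f \<in> edges G \<Longrightarrow>
    sv' e * sv f - (if e = f then pv (rng G e) else 0) \<in> leavitt_relations G"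
| p_sum: "v \<in> verts G \<Longrightarrow> {e \<in> edges G. src G e = v} \<noteq> {} \<Longrightarrow>
    finite {e \<in> edges G. src G e = v} \<Longrightarrow>
    pv {v} - (\<Sum>e \<in> {e \<in> edges G. src G e = v}. sv e * sv' e) \<in> leavitt_relations G"

inductive_set leavitt_ideal ::
    "('v, 'e) ultragraph_data \<Rightarrow> ('v, 'e, 'r::comm_ring_1) free_alg set"
  for G :: "('v, 'e) ultragraph_data" where
  relation: "x \<in> leavitt_relations G \<Longrightarrow> x \<in> leavitt_ideal G"
| zero: "0 \<in> leavitt_ideal G"
| add: "x \<in> leavitt_ideal G \<Longrightarrow> y \<in> leavitt_ideal G \<Longrightarrow> x + y \<in> leavitt_ideal G"
| smul: "x \<in> leavitt_ideal G \<Longrightarrow> smul c x \<in> leavitt_ideal G"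
| mult_left: "x \<in> leavitt_ideal G \<Longrightarrow> y \<in> free_on G \<Longrightarrow> y * x \<in> leavitt_ideal G"
| mult_right: "x \<in> leavitt_ideal G \<Longrightarrow> y \<in> free_on G \<Longrightarrow> x * y \<in> leavitt_ideal G"

definition leavitt_rel ::
    "('v, 'e) ultragraph_data \<Rightarrow> (('v, 'e, 'r::comm_ring_1) free_alg \<times> ('v, 'e, 'r) free_alg) set" where
  "leavitt_rel G = {(x, y). x \<in> free_on G \<and> y \<in> free_on G \<and> x - y \<in> leavitt_ideal G}"

definition leavitt_class ::
    "('v, 'e) ultragraph_data \<Rightarrow> ('v, 'e, 'r::comm_ring_1) free_alg \<Rightarrow> ('v, 'e, 'r) free_alg set" where
  "leavitt_class G x = leavitt_rel G `` {x}"

definition leavitt_algebra ::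
    "('v, 'e) ultragraph_data \<Rightarrow> ('v, 'e, 'r::comm_ring_1) free_alg set set" where
  "leavitt_algebra G = free_on G // leavitt_rel G"


section \<open>The representation on the free module over the paths\<close>

text \<open>\<^term>\<open>Fin a v\<close> is the pair \<open>(a, v)\<close> ending in the sink \<open>v\<close>; \<^term>\<open>Fin [] v\<close> is the pair \<open>(v, v)\<close>.\<close>

datatype ('v, 'e) upath = Fin "'e list" 'v | Inf "nat \<Rightarrow> 'e"

definition paths :: "('v, 'e) ultragraph_data \<Rightarrow> ('v, 'e) upath set" where
  "paths G = {Fin a v |a v. fin_path G a \<and> v \<in> rng G (last a) \<inter> sinks G}
     \<union> {Fin [] v |v. v \<in> sinks G} \<union> {Inf p |p. inf_path G p}"

fun path_src :: "('v, 'e) ultragraph_data \<Rightarrow> ('v, 'e) upath \<Rightarrow> 'v" where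
  "path_src G (Fin [] v) = v"
| "path_src G (Fin (e # a) v) = src G e"
| "path_src G (Inf p) = src G (p 0)"

fun path_cons :: "'e \<Rightarrow> ('v, 'e) upath \<Rightarrow> ('v, 'e) upath" where
  "path_cons e (Fin a v) = Fin (e # a) v"
| "path_cons e (Inf p) = Inf (case_nat e p)"

fun gen_act ::
    "('v, 'e) ultragraph_data \<Rightarrow> ('v, 'e) gen \<Rightarrow> ('v, 'e) upath \<Rightarrow> (('v, 'e) upath \<Rightarrow>\<^sub>0 'r::comm_ring_1)" where
  "gen_act G (P A) q = (if path_src G q \<in> A then Poly_Mapping.single q 1 else 0)"
| "gen_act G (S e) q =
     (if path_src G q \<in> rng G e then Poly_Mapping.single (path_cons e q) 1 else 0)"
| "gen_act G (Sstar e) (Fin [] v) = 0"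
| "gen_act G (Sstar e) (Fin (f # a) v) = (if f = e then Poly_Mapping.single (Fin a v) 1 else 0)"
| "gen_act G (Sstar e) (Inf p) =
     (if p 0 = e then Poly_Mapping.single (Inf (\<lambda>n. p (Suc n))) 1 else 0)"

definition path_module :: "('v, 'e) ultragraph_data \<Rightarrow> (('v, 'e) upath \<Rightarrow>\<^sub>0 'r::comm_ring_1) set" where
  "path_module G = {m. Poly_Mapping.keys m \<subseteq> paths G}"

definition endos :: "('b \<Rightarrow>\<^sub>0 'r::comm_ring_1) set \<Rightarrow> (('b \<Rightarrow>\<^sub>0 'r) \<Rightarrow> ('b \<Rightarrow>\<^sub>0 'r)) set" where
  "endos M = {f \<in> M \<rightarrow>\<^sub>E M. (\<forall>x\<in>M. \<forall>y\<in>M. f (x + y) = f x + f y) \<and> (\<forall>c. \<forall>x\<in>M. f (smul c x) = smul c (f x))}"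

definition lin_ext :: "('a \<Rightarrow> ('b \<Rightarrow>\<^sub>0 'r)) \<Rightarrow> ('a \<Rightarrow>\<^sub>0 'r::comm_ring_1) \<Rightarrow> ('b \<Rightarrow>\<^sub>0 'r)" where
  "lin_ext f x = (\<Sum>k \<in> Poly_Mapping.keys x. smul (Poly_Mapping.lookup x k) (f k))"

definition free_act ::
    "('v, 'e) ultragraph_data \<Rightarrow> ('v, 'e, 'r::comm_ring_1) free_alg \<Rightarrow>
      (('v, 'e) upath \<Rightarrow>\<^sub>0 'r) \<Rightarrow> (('v, 'e) upath \<Rightarrow>\<^sub>0 'r)" where
  "free_act G x m = lin_ext (\<lambda>w. foldr (\<lambda>g. lin_ext (gen_act G g)) (letters w) m) x"

text \<open>The representation. All elements of a class act on the path module in the same way, as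
  shown by \<open>path_rep_class\<close> below.\<close>

definition path_rep ::
    "('v, 'e) ultragraph_data \<Rightarrow> ('v, 'e, 'r::comm_ring_1) free_alg set \<Rightarrow>
      (('v, 'e) upath \<Rightarrow>\<^sub>0 'r) \<Rightarrow> (('v, 'e) upath \<Rightarrow>\<^sub>0 'r)" where
  "path_rep G X = the_elem ((\<lambda>x. restrict (free_act G x) (path_module G)) ` X)"

subsection \<open>Well-definedness\<close>

lemma lookup_smul [simp]: "Poly_Mapping.lookup (smul c x) k = c * Poly_Mapping.lookup x k"
  by (simp add: smul_def Poly_Mapping.map.rep_eq when_def)

lemma smul_simps [simp]:
  "smul 0 x = 0" "smul c 0 = 0" "smul 1 x = x" "smul c (smul d x) = smul (c * d) x"
  by (rule poly_mapping_eqI; simp add: mult.assoc)+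

lemma smul_add: "smul c (x + y) = smul c x + smul c y"
  by (rule poly_mapping_eqI) (simp add: lookup_add distrib_left)

lemma smul_add_left: "smul (c + d) x = smul c x + smul d x"
  by (rule poly_mapping_eqI) (simp add: lookup_add distrib_right)

lemma smul_sum: "smul c (sum f I) = (\<Sum>i\<in>I. smul c (f i))"
  by (induction I rule: infinite_finite_induct) (simp_all add: smul_add)

lemma smul_minus_one: "smul (-1) x = - x"
  by (rule poly_mapping_eqI) simp

lemma smul_single: "smul c (Poly_Mapping.single k d) = Poly_Mapping.single k (c * d)"
  by (rule poly_mapping_eqI) (simp add: lookup_single when_def)

lemma keys_smul: "Poly_Mapping.keys (smul c x) \<subseteq> Poly_Mapping.keys x"
proof
  fix k assume "k \<in> Poly_Mapping.keys (smul c x)"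
  then show "k \<in> Poly_Mapping.keys x"
    by (cases "Poly_Mapping.lookup x k = 0") (simp_all add: in_keys_iff)
qed

lemma poly_mapping_add_induct:
  fixes x :: "'a \<Rightarrow>\<^sub>0 'r::comm_ring_1"
  assumes "\<And>k c. Q (Poly_Mapping.single k c)" and "\<And>x y. Q x \<Longrightarrow> Q y \<Longrightarrow> Q (x + y)"
  shows "Q x"
proof (induction x rule: update_induct)
  case const
  show ?case using assms(1)[of undefined 0] by simp
next
  case (update p a b)
  have "Poly_Mapping.update a b p = p + Poly_Mapping.single a b"
    using update(1) by (intro poly_mapping_eqI)
      (auto simp: lookup_update lookup_add lookup_single when_def in_keys_iff)
  then show ?case using update assms by simp
qed

lemma lin_ext_superset:
  assumes "finite K" "Poly_Mapping.keys x \<subseteq> K"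
  shows "lin_ext f x = (\<Sum>k\<in>K. smul (Poly_Mapping.lookup x k) (f k))"
  unfolding lin_ext_def by (intro sum.mono_neutral_left assms) (auto simp: in_keys_iff)

lemma lin_ext_zero [simp]: "lin_ext f 0 = 0"
  by (simp add: lin_ext_def)

lemma lin_ext_add: "lin_ext f (x + y) = lin_ext f x + lin_ext f y"
proof -
  let ?K = "Poly_Mapping.keys x \<union> Poly_Mapping.keys y"
  have "Poly_Mapping.keys (x + y) \<subseteq> ?K" by (rule keys_add)
  then show ?thesis
    by (simp add: lin_ext_superset[of ?K] lookup_add smul_add_left sum.distrib)
qed

lemma lin_ext_smul: "lin_ext f (smul c x) = smul c (lin_ext f x)"
  using lin_ext_superset[where x = "smul c x" and f = f, OF finite_keys keys_smul]
  by (simp add: smul_sum lin_ext_def[of f x])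

lemma lin_ext_single [simp]: "lin_ext f (Poly_Mapping.single k c) = smul c (f k)"
  by (simp add: lin_ext_superset[of "{k}"])

lemma lin_ext_fun_add: "lin_ext (\<lambda>k. f k + g k) x = lin_ext f x + lin_ext g x"
  by (simp add: lin_ext_def smul_add sum.distrib)

lemma lin_ext_fun_smul: "lin_ext (\<lambda>k. smul c (f k)) x = smul c (lin_ext f x)"
  by (simp add: lin_ext_def smul_sum mult.commute)

lemma keys_lin_ext:
  assumes "\<And>k. k \<in> Poly_Mapping.keys x \<Longrightarrow> Poly_Mapping.keys (f k) \<subseteq> Q"
  shows "Poly_Mapping.keys (lin_ext f x) \<subseteq> Q"
proof
  fix q assume "q \<in> Poly_Mapping.keys (lin_ext f x)"
  then have "(\<Sum>k\<in>Poly_Mapping.keys x. Poly_Mapping.lookup x k * Poly_Mapping.lookup (f k) q) \<noteq> 0"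
    by (simp add: in_keys_iff lin_ext_def lookup_sum)
  then obtain k where "k \<in> Poly_Mapping.keys x" "Poly_Mapping.lookup (f k) q \<noteq> 0"
    by (metis (no_types, lifting) mult_zero_right sum.neutral)
  then show "q \<in> Q" using assms by (auto simp: in_keys_iff subset_iff)
qed

abbreviation "word_act G w \<equiv> foldr (\<lambda>g. lin_ext (gen_act G g)) (letters w)"

lemma word_act_add: "word_act G w (m + n) = word_act G w m + word_act G w n"
proof -
  have "foldr (\<lambda>g. lin_ext (gen_act G g)) gs (m + n) =
        foldr (\<lambda>g. lin_ext (gen_act G g)) gs m + foldr (\<lambda>g. lin_ext (gen_act G g)) gs n" for gs
    by (induction gs) (simp_all add: lin_ext_add)
  then show ?thesis .
qed

lemma word_act_smul: "word_act G w (smul c m) = smul c (word_act G w m)"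
proof -
  have "foldr (\<lambda>g. lin_ext (gen_act G g)) gs (smul c m) =
        smul c (foldr (\<lambda>g. lin_ext (gen_act G g)) gs m)" for gs
    by (induction gs) (simp_all add: lin_ext_smul)
  then show ?thesis .
qed

lemma free_act_zero [simp]: "free_act G 0 m = 0"
  by (simp add: free_act_def)

lemma free_act_add: "free_act G (x + y) m = free_act G x m + free_act G y m"
  by (simp add: free_act_def lin_ext_add)

lemma free_act_smul: "free_act G (smul c x) m = smul c (free_act G x m)"
  by (simp add: free_act_def lin_ext_smul)

lemma free_act_minus: "free_act G (- x) m = - free_act G x m"
  using free_act_smul[of G "-1" x m] by (simp add: smul_minus_one)

lemma free_act_diff: "free_act G (x - y) m = free_act G x m - free_act G y m"
  using free_act_add[of G x "- y" m] by (simp add: free_act_minus)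

lemma free_act_sum: "free_act G (sum f I) m = (\<Sum>i\<in>I. free_act G (f i) m)"
  by (induction I rule: infinite_finite_induct) (simp_all add: free_act_add)

lemma free_act_add_right: "free_act G x (m + n) = free_act G x m + free_act G x n"
  by (simp add: free_act_def word_act_add lin_ext_fun_add)

lemma free_act_smul_right: "free_act G x (smul c m) = smul c (free_act G x m)"
  by (simp add: free_act_def word_act_smul lin_ext_fun_smul)

lemma free_act_zero_right [simp]: "free_act G x 0 = 0"
  using free_act_smul_right[of G x 0 0] by simp

lemma free_act_single: "free_act G (Poly_Mapping.single w c) m = smul c (word_act G w m)"
  by (simp add: free_act_def)

lemma free_act_mult: "free_act G (x * y) m = free_act G x (free_act G y m)"
proof (induction x rule: poly_mapping_add_induct)
  case (1 u c)
  show ?case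
  proof (induction y rule: poly_mapping_add_induct)
    case (1 w d)
    show ?case
      by (simp add: mult_single free_act_single plus_word_def word_act_smul)
  qed (simp add: distrib_left free_act_add free_act_add_right)
qed (simp add: distrib_right free_act_add)

lemma free_act_gvar: "free_act G (gvar g) m = lin_ext (gen_act G g) m"
  by (simp add: gvar_def free_act_single)

lemma path_module_add: "m \<in> path_module G \<Longrightarrow> n \<in> path_module G \<Longrightarrow> m + n \<in> path_module G"
  unfolding path_module_def using keys_add[of m n] by auto

lemma path_module_smul: "m \<in> path_module G \<Longrightarrow> smul c m \<in> path_module G"
  unfolding path_module_def using keys_smul[of c m] by auto

lemma fin_path_Cons:
  "fin_path G (e # a) \<longleftrightarrow> e \<in> edges G \<and> (a = [] \<or> fin_path G a \<and> src G (hd a) \<in> rng G e)"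
  unfolding fin_path_def by (cases a) (auto simp: nth_Cons split: nat.splits)

lemma inf_path_case_nat:
  "inf_path G (case_nat e p) \<longleftrightarrow> e \<in> edges G \<and> src G (p 0) \<in> rng G e \<and> inf_path G p"
  unfolding inf_path_def by (auto split: nat.splits)

lemma paths_Fin_iff: "Fin a v \<in> paths G \<longleftrightarrow> v \<in> sinks G \<and> (a = [] \<or> fin_path G a \<and> v \<in> rng G (last a))"
  by (auto simp: paths_def)

lemma paths_Inf_iff: "Inf p \<in> paths G \<longleftrightarrow> inf_path G p"
  by (auto simp: paths_def)

lemma path_cons_in_paths:
  assumes "e \<in> edges G" "q \<in> paths G" "path_src G q \<in> rng G e"
  shows "path_cons e q \<in> paths G"
proof (cases q)
  case (Fin a v)
  then show ?thesis using assms by (cases a) (auto simp: paths_Fin_iff fin_path_Cons)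
next
  case (Inf p)
  then show ?thesis using assms by (auto simp: paths_Inf_iff inf_path_case_nat)
qed

lemma Inf_eq_path_cons: "Inf p = path_cons (p 0) (Inf (\<lambda>n. p (Suc n)))"
  by (auto split: nat.splits)

lemma paths_cases:
  assumes "q \<in> paths G"
  obtains (sink) v where "q = Fin [] v" "v \<in> sinks G"
    | (cons) e q' where "q = path_cons e q'" "e \<in> edges G" "q' \<in> paths G" "path_src G q' \<in> rng G e"
proof (cases q)
  case (Fin a v)
  show ?thesis
  proof (cases a)
    case Nil
    then show ?thesis using Fin assms sink by (auto simp: paths_Fin_iff)
  next
    case (Cons e b)
    then show ?thesis using Fin assms cons[of e "Fin b v"]
      by (cases b) (auto simp: paths_Fin_iff fin_path_Cons)
  qed
next
  case (Inf p)
  then have "inf_path G p" using assms by (simp add: paths_Inf_iff)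
  then show ?thesis using Inf cons[of "p 0" "Inf (\<lambda>n. p (Suc n))"] Inf_eq_path_cons[of p]
    by (auto simp: inf_path_def paths_Inf_iff)
qed

lemma path_src_path_cons [simp]: "path_src G (path_cons e q) = src G e"
  by (cases q) auto

lemma gen_act_Sstar_path_cons [simp]:
  "gen_act G (Sstar e) (path_cons f q) = (if f = e then Poly_Mapping.single q 1 else 0)"
  by (cases q) auto

lemma keys_gen_act:
  assumes "g \<in> gens G" "q \<in> paths G"
  shows "Poly_Mapping.keys (gen_act G g q :: _ \<Rightarrow>\<^sub>0 'r::comm_ring_1) \<subseteq> paths G"
  using assms(2)
proof (cases rule: paths_cases)
  case (sink v)
  then show ?thesis using assms path_cons_in_paths[of _ G q] by (cases g) (auto simp: gens_def)
next
  case (cons e q')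
  then show ?thesis using assms path_cons_in_paths[of _ G q] by (cases g) (auto simp: gens_def)
qed

lemma word_act_in_path_module:
  assumes "set (letters w) \<subseteq> gens G" "m \<in> path_module G"
  shows "word_act G w m \<in> path_module G"
proof -
  have "foldr (\<lambda>g. lin_ext (gen_act G g)) gs m \<in> path_module G" if "set gs \<subseteq> gens G" for gs
    using that
  proof (induction gs)
    case (Cons g gs)
    let ?n = "foldr (\<lambda>g. lin_ext (gen_act G g)) gs m"
    have "?n \<in> path_module G" "g \<in> gens G" using Cons by auto
    then have "Poly_Mapping.keys (lin_ext (gen_act G g) ?n) \<subseteq> paths G"
      by (intro keys_lin_ext keys_gen_act) (auto simp: path_module_def)
    then show ?case by (simp add: path_module_def)
  qed (use assms in simp)
  then show ?thesis using assms by blast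
qed

lemma free_act_in_path_module:
  assumes "x \<in> free_on G" "m \<in> path_module G"
  shows "free_act G x m \<in> path_module G"
  using word_act_in_path_module[OF _ assms(2)] assms(1)
  unfolding free_act_def free_on_def path_module_def mem_Collect_eq
  by (intro keys_lin_ext) blast

lemma lin_zero_on_path_module:
  fixes f :: "(('v, 'e) upath \<Rightarrow>\<^sub>0 'r::comm_ring_1) \<Rightarrow> (('v, 'e) upath \<Rightarrow>\<^sub>0 'r)"
  assumes "\<And>m n. f (m + n) = f m + f n" "\<And>c m. f (smul c m) = smul c (f m)"
    and "\<And>q. q \<in> paths G \<Longrightarrow> f (Poly_Mapping.single q 1) = 0" and "m \<in> path_module G"
  shows "f m = 0"
proof -
  have f0: "f 0 = 0" using assms(2)[of 0 0] by simp
  have s: "f (sum h I) = (\<Sum>i\<in>I. f (h i))" for h and I :: "('v, 'e) upath set"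
    by (induction I rule: infinite_finite_induct) (simp_all add: assms f0)
  have "m = lin_ext (\<lambda>q. Poly_Mapping.single q 1) m"
    by (induction m rule: poly_mapping_add_induct) (simp_all add: smul_single lin_ext_add)
  then have "f m = (\<Sum>q\<in>Poly_Mapping.keys m.
      smul (Poly_Mapping.lookup m q) (f (Poly_Mapping.single q 1)))"
    by (metis (no_types, lifting) s assms(2) lin_ext_def sum.cong)
  also have "\<dots> = 0" using assms(3,4) by (intro sum.neutral) (auto simp: path_module_def)
  finally show ?thesis .
qed

lemma relation_act_basis:
  fixes x :: "('v, 'e, 'r::comm_ring_1) free_alg"
  assumes "x \<in> leavitt_relations G" "q \<in> paths G"
  shows "free_act G x (Poly_Mapping.single q 1) = 0"
  using assms(1)
proof cases
  case (p_sum v)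
  let ?E = "{e \<in> edges G. src G e = v}"
  show ?thesis using assms(2)
  proof (cases rule: paths_cases)
    case (sink w)
    then show ?thesis using p_sum
      by (auto simp: free_act_diff free_act_sum free_act_mult free_act_gvar sinks_def)
  next
    case (cons f q')
    have "free_act G (\<Sum>e\<in>?E. sv e * sv' e) (Poly_Mapping.single q 1) =
        (\<Sum>e\<in>?E. if f = e then Poly_Mapping.single q (1::'r) else 0)"
      unfolding free_act_sum
      by (rule sum.cong) (use cons in \<open>auto simp: free_act_mult free_act_gvar\<close>)
    then show ?thesis using p_sum cons
      by (auto simp: free_act_diff free_act_gvar)
  qed
qed (use assms(2) in \<open>cases rule: paths_cases; auto simp: free_act_diff free_act_add free_act_mult free_act_gvar\<close>)+

lemma leavitt_ideal_act:
  assumes "x \<in> leavitt_ideal G" "m \<in> path_module G"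
  shows "free_act G x m = 0"
  using assms
proof (induction x arbitrary: m)
  case (relation x)
  show ?case
    by (rule lin_zero_on_path_module[OF _ _ _ relation(2)])
       (simp_all add: free_act_add_right free_act_smul_right relation_act_basis relation(1))
qed (simp_all add: free_act_add free_act_smul free_act_mult free_act_in_path_module)

lemma free_on_add: "x \<in> free_on G \<Longrightarrow> y \<in> free_on G \<Longrightarrow> x + y \<in> free_on G"
  unfolding free_on_def using keys_add[of x y] by auto

lemma free_on_smul: "x \<in> free_on G \<Longrightarrow> smul c x \<in> free_on G"
  unfolding free_on_def using keys_smul[of c x] by auto

lemma free_on_mult:
  assumes "x \<in> free_on G" "y \<in> free_on G"
  shows "x * y \<in> free_on G"
  using keys_mult[of x y] assms unfolding free_on_def by (fastforce simp: plus_word_def)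

lemma free_on_gvar: "g \<in> gens G \<Longrightarrow> gvar g \<in> free_on G"
  by (simp add: free_on_def gvar_def)

lemma equiv_leavitt_rel: "equiv (free_on G) (leavitt_rel G)"
proof (rule equivI)
  show "leavitt_rel G \<subseteq> free_on G \<times> free_on G"
    by (auto simp: leavitt_rel_def)
  show "refl_on (free_on G) (leavitt_rel G)"
    by (auto simp: refl_on_def leavitt_rel_def leavitt_ideal.zero)
  show "sym (leavitt_rel G)"
  proof (rule symI)
    fix x y assume "(x, y) \<in> leavitt_rel G"
    then show "(y, x) \<in> leavitt_rel G"
      using leavitt_ideal.smul[of "x - y" G "-1"] by (simp add: leavitt_rel_def smul_minus_one)
  qed
  show "trans (leavitt_rel G)"
  proof (rule transI)
    fix x y z assume "(x, y) \<in> leavitt_rel G" "(y, z) \<in> leavitt_rel G"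
    then show "(x, z) \<in> leavitt_rel G"
      using leavitt_ideal.add[of "x - y" G "y - z"] by (simp add: leavitt_rel_def)
  qed
qed

lemma leavitt_class_eq_iff:
  "x \<in> free_on G \<Longrightarrow> y \<in> free_on G \<Longrightarrow> leavitt_class G x = leavitt_class G y \<longleftrightarrow> x - y \<in> leavitt_ideal G"
  unfolding leavitt_class_def eq_equiv_class_iff[OF equiv_leavitt_rel] by (simp add: leavitt_rel_def)

lemma leavitt_algebra_eq: "leavitt_algebra G = leavitt_class G ` free_on G"
  by (auto simp: leavitt_algebra_def leavitt_class_def quotient_def)

lemma path_rep_class:
  assumes "x \<in> free_on G"
  shows "path_rep G (leavitt_class G x) = restrict (free_act G x) (path_module G)"
proof -
  have "restrict (free_act G y) (path_module G) = restrict (free_act G x) (path_module G)"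
    if "y \<in> leavitt_class G x" for y
    using that leavitt_ideal_act[of "x - y" G]
    by (intro restrict_ext) (auto simp: leavitt_class_def leavitt_rel_def free_act_diff)
  moreover have "x \<in> leavitt_class G x"
    using assms by (simp add: leavitt_class_def leavitt_rel_def leavitt_ideal.zero)
  ultimately have "(\<lambda>y. restrict (free_act G y) (path_module G)) ` leavitt_class G x =
      {restrict (free_act G x) (path_module G)}"
    by blast
  then show ?thesis
    by (simp only: path_rep_def the_elem_eq)
qed

theorem path_rep_in_endos:
  assumes "X \<in> leavitt_algebra G"
  shows "path_rep G X \<in> endos (path_module G)"
proof -
  obtain x where x: "x \<in> free_on G" and X: "X = leavitt_class G x"
    using assms unfolding leavitt_algebra_eq by blast
  have "restrict (free_act G x) (path_module G) \<in> path_module G \<rightarrow>\<^sub>E path_module G"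
    using free_act_in_path_module[OF x] by (simp add: restrict_PiE_iff)
  then show ?thesis
    unfolding X path_rep_class[OF x] endos_def
    by (simp add: path_module_add path_module_smul free_act_add_right free_act_smul_right)
qed

theorem path_rep_hom:
  assumes "x \<in> free_on G" "y \<in> free_on G" "m \<in> path_module G"
  shows "path_rep G (leavitt_class G (x + y)) m =
      path_rep G (leavitt_class G x) m + path_rep G (leavitt_class G y) m"
    and "path_rep G (leavitt_class G (smul c x)) m = smul c (path_rep G (leavitt_class G x) m)"
    and "path_rep G (leavitt_class G (x * y)) m =
      path_rep G (leavitt_class G x) (path_rep G (leavitt_class G y) m)"
  using assms by (simp_all add: path_rep_class free_on_add free_on_smul free_on_mult
      free_act_in_path_module free_act_add free_act_smul free_act_mult)

theorem path_rep_gvar: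
  assumes "g \<in> gens G" "q \<in> paths G"
  shows "path_rep G (leavitt_class G (gvar g)) (Poly_Mapping.single q 1) = gen_act G g q"
  using assms by (simp add: path_rep_class free_on_gvar free_act_gvar path_module_def)

end

theory Submission
  imports Defs
begin

text \<open>
  If a closed path \<open>a\<close> has no exit, then \<open>a a a \<dots>\<close> is the only path starting at its source \<open>v\<close>, and
  prefixing \<open>a\<close> to it changes nothing. Hence \<open>s\<^sub>a\<close> and \<open>p\<^sub>v\<close> act in the same way
  (\<open>closed_path_without_exit_acts_as_vertex\<close>). They are distinct in the algebra: the defining
  relations are homogeneous for the degree that counts edges minus ghost edges, \<open>s\<^sub>a\<close> and \<open>p\<^sub>v\<close> have
  different degrees, and \<open>p\<^sub>v\<close> is not zero (\<open>spath_minus_pv_notin_ideal\<close>).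

  Conversely, assume Condition (L), and let \<open>x\<close> act as zero. Write \<open>x = D + (\<Sum>f\<in>F. y\<^sub>f s\<^sub>f\<^sup>*)\<close>, where \<open>D\<close>
  is a combination of monomials \<open>s\<^sub>a p\<^sub>A\<close> without ghost edges and each \<open>y\<^sub>f\<close> has fewer ghost edges
  than \<open>x\<close>. Then \<open>x s\<^sub>f = D s\<^sub>f + y\<^sub>f\<close> acts as zero and has fewer ghost edges, so it is zero by
  induction. Substituting \<open>y\<^sub>f = - D s\<^sub>f\<close> gives \<open>x = D (1 - (\<Sum>f\<in>F. s\<^sub>f s\<^sub>f\<^sup>*))\<close>
  (\<open>star_expandable_faithful\<close>). The last factor restricts to the paths that do not begin with an edge
  in \<open>F\<close>.

  It remains to see that such an element is zero (\<open>analytic_off_edges_zero\<close>). Collecting terms,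
  \<open>D = (\<Sum>a. s\<^sub>a g\<^sub>a)\<close>, where \<open>g\<^sub>a\<close> is a combination of idempotents \<open>p\<^sub>A\<close> and so amounts to a function on the
  vertices (\<open>sum_pv_eq_0\<close>). A path \<open>q\<close> from \<open>v\<close> that does not begin in \<open>F\<close> is sent to the combination
  of the \<open>a q\<close> with coefficients \<open>g\<^sub>a(v)\<close>. Two of the paths \<open>a q\<close> can coincide only if \<open>q\<close> has a
  short period, and Condition (L) allows \<open>q\<close> to be chosen without one (\<open>exists_aperiodic_path\<close>):
  run along a periodic path for long enough and then leave through an exit. Therefore \<open>g\<^sub>a(v) = 0\<close>
  unless \<open>v\<close> emits edges and all of them lie in the finite set \<open>F\<close>; at these finitely many
  vertices \<open>p\<^sub>v (1 - (\<Sum>f\<in>F. s\<^sub>f s\<^sub>f\<^sup>*)) = 0\<close> is one of the defining relations.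
\<close>

section \<open>Linear combinations and the convolution product\<close>

lemma poly_mapping_keys_induct [consumes 1, case_names zero single add]:
  fixes x :: "'a \<Rightarrow>\<^sub>0 'b::comm_monoid_add"
  assumes "Poly_Mapping.keys x \<subseteq> V"
    and "Q 0" "\<And>k c. k \<in> V \<Longrightarrow> Q (Poly_Mapping.single k c)" "\<And>x y. Q x \<Longrightarrow> Q y \<Longrightarrow> Q (x + y)"
  shows "Q x"
proof -
  have "Q (\<Sum>k\<in>K. Poly_Mapping.single k (Poly_Mapping.lookup x k))" if "finite K" "K \<subseteq> V" for K
    using that by (induction K rule: finite_induct) (auto intro: assms)
  moreover have "(\<Sum>k\<in>Poly_Mapping.keys x. Poly_Mapping.single k (Poly_Mapping.lookup x k)) = x"
    by (intro poly_mapping_eqI) (auto simp: lookup_sum lookup_single when_def in_keys_iff)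
  ultimately show ?thesis using assms(1) by (metis finite_keys)
qed

lemma smul_conv_mult_left: "smul c x = Poly_Mapping.single 0 c * (x :: 'b::monoid_add \<Rightarrow>\<^sub>0 'r::comm_ring_1)"
  by (induction x rule: poly_mapping_add_induct)
    (simp_all add: smul_single mult_single smul_add distrib_left)

lemma smul_conv_mult_right: "smul c x = (x :: 'b::monoid_add \<Rightarrow>\<^sub>0 'r::comm_ring_1) * Poly_Mapping.single 0 c"
  by (induction x rule: poly_mapping_add_induct)
    (simp_all add: smul_single mult_single smul_add distrib_right mult.commute)

lemma smul_mult_left: "smul c x * y = smul c (x * y :: 'b::monoid_add \<Rightarrow>\<^sub>0 'r::comm_ring_1)"
  by (simp add: smul_conv_mult_left mult.assoc)

lemma smul_mult_right: "x * smul c y = smul c (x * y :: 'b::monoid_add \<Rightarrow>\<^sub>0 'r::comm_ring_1)"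
  by (simp add: smul_conv_mult_right mult.assoc)

lemma smul_minus_left: "smul (- c) x = - smul c x"
  by (rule poly_mapping_eqI) simp

lemma smul_diff: "smul c (x - y) = smul c x - smul c y"
  by (rule poly_mapping_eqI) (simp add: lookup_minus right_diff_distrib)

section \<open>Calculating modulo the defining relations\<close>

text \<open>The subalgebra of the unital free algebra on the generators of \<open>G\<close>, empty word included. The
Leavitt ideal is an ideal of this larger algebra too, so a computation in the non-unital algebra
may pass through \<open>1\<close>, as in the factor \<open>1 - (\<Sum>f\<in>F. s\<^sub>f s\<^sub>f\<^sup>*)\<close>.\<close>

definition alg_on :: "('v, 'e) ultragraph_data \<Rightarrow> ('v, 'e, 'r::comm_ring_1) free_alg set" where
  "alg_on G = {x. \<forall>w \<in> Poly_Mapping.keys x. set (letters w) \<subseteq> gens G}"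

lemma free_on_subset_alg_on: "x \<in> free_on G \<Longrightarrow> x \<in> alg_on G"
  by (auto simp: free_on_def alg_on_def)

lemma alg_on_induct [consumes 1, case_names zero single add]:
  assumes "x \<in> alg_on G" "Q 0"
    "\<And>w c. set (letters w) \<subseteq> gens G \<Longrightarrow> Q (Poly_Mapping.single w c)"
    "\<And>x y. Q x \<Longrightarrow> Q y \<Longrightarrow> Q (x + y)"
  shows "Q x"
  by (rule poly_mapping_keys_induct[where V = "{w. set (letters w) \<subseteq> gens G}"])
    (use assms in \<open>auto simp: alg_on_def\<close>)

lemma alg_on_zero [simp]: "0 \<in> alg_on G"
  and alg_on_one [simp]: "1 \<in> alg_on G"
  by (simp_all add: alg_on_def zero_word_def)

lemma alg_on_add [intro]: "x \<in> alg_on G \<Longrightarrow> y \<in> alg_on G \<Longrightarrow> x + y \<in> alg_on G"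
  unfolding alg_on_def using keys_add[of x y] by auto

lemma alg_on_smul [intro]: "x \<in> alg_on G \<Longrightarrow> smul c x \<in> alg_on G"
  unfolding alg_on_def using keys_smul[of c x] by auto

lemma alg_on_minus [intro]: "x \<in> alg_on G \<Longrightarrow> - x \<in> alg_on G"
  by (metis alg_on_smul smul_minus_one)

lemma alg_on_diff [intro]: "x \<in> alg_on G \<Longrightarrow> y \<in> alg_on G \<Longrightarrow> x - y \<in> alg_on G"
  using alg_on_add[of x G "- y"] by auto

lemma alg_on_mult [intro]: "x \<in> alg_on G \<Longrightarrow> y \<in> alg_on G \<Longrightarrow> x * y \<in> alg_on G"
  using keys_mult[of x y] unfolding alg_on_def by (fastforce simp: plus_word_def)

lemma alg_on_sum [intro]: "(\<And>i. i \<in> I \<Longrightarrow> f i \<in> alg_on G) \<Longrightarrow> sum f I \<in> alg_on G"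
  by (induction I rule: infinite_finite_induct) auto

lemma alg_on_single [intro]: "set (letters w) \<subseteq> gens G \<Longrightarrow> Poly_Mapping.single w c \<in> alg_on G"
  by (simp add: alg_on_def)

lemma alg_on_gvar:
  "A \<in> gen_verts G \<Longrightarrow> pv A \<in> alg_on G"
  "e \<in> edges G \<Longrightarrow> sv e \<in> alg_on G"
  "e \<in> edges G \<Longrightarrow> sv' e \<in> alg_on G"
  by (auto simp: gvar_def gens_def)

lemma leavitt_ideal_minus: "x \<in> leavitt_ideal G \<Longrightarrow> - x \<in> leavitt_ideal G"
  by (metis leavitt_ideal.smul smul_minus_one)

lemma single_mult_leavitt_ideal:
  assumes "x \<in> leavitt_ideal G" "set (letters w) \<subseteq> gens G"
  shows "Poly_Mapping.single w c * x \<in> leavitt_ideal G"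
    and "x * Poly_Mapping.single w c \<in> leavitt_ideal G"
proof -
  have "Poly_Mapping.single w c * x \<in> leavitt_ideal G \<and> x * Poly_Mapping.single w c \<in> leavitt_ideal G"
  proof (cases "letters w = []")
    case True
    then have "w = 0" by (cases w) (simp add: zero_word_def)
    then show ?thesis using assms(1)
      by (simp flip: smul_conv_mult_left smul_conv_mult_right add: leavitt_ideal.smul)
  next
    case False
    then have "Poly_Mapping.single w c \<in> free_on G" using assms(2) by (simp add: free_on_def)
    then show ?thesis using assms(1) by (simp add: leavitt_ideal.mult_left leavitt_ideal.mult_right)
  qed
  then show "Poly_Mapping.single w c * x \<in> leavitt_ideal G"
    "x * Poly_Mapping.single w c \<in> leavitt_ideal G" by auto
qed

lemma alg_on_mult_leavitt_ideal:
  assumes "y \<in> alg_on G" "x \<in> leavitt_ideal G"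
  shows "y * x \<in> leavitt_ideal G" and "x * y \<in> leavitt_ideal G"
proof -
  show "y * x \<in> leavitt_ideal G" using assms(1)
    by (induction y rule: alg_on_induct)
      (simp_all add: leavitt_ideal.zero single_mult_leavitt_ideal assms(2) distrib_right leavitt_ideal.add)
  show "x * y \<in> leavitt_ideal G" using assms(1)
    by (induction y rule: alg_on_induct)
      (simp_all add: leavitt_ideal.zero single_mult_leavitt_ideal assms(2) distrib_left leavitt_ideal.add)
qed

text \<open>Membership of both sides in \<^const>\<open>alg_on\<close> is part of the congruence, because the ideal absorbs
only factors from there: in this form the congruence is compatible with products without side
conditions.\<close>

definition leavitt_eq ::
    "('v, 'e, 'r::comm_ring_1) free_alg \<Rightarrow> ('v, 'e) ultragraph_data \<Rightarrow> ('v, 'e, 'r) free_alg \<Rightarrow> bool"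
    ("(_ \<approx>\<^bsub>_\<^esub>/ _)" [51, 0, 51] 50) where
  "x \<approx>\<^bsub>G\<^esub> y \<longleftrightarrow> x \<in> alg_on G \<and> y \<in> alg_on G \<and> x - y \<in> leavitt_ideal G"

lemma leavitt_eq_alg_on: "x \<approx>\<^bsub>G\<^esub> y \<Longrightarrow> x \<in> alg_on G" "x \<approx>\<^bsub>G\<^esub> y \<Longrightarrow> y \<in> alg_on G"
  by (simp_all add: leavitt_eq_def)

lemma leavitt_eq_refl: "x \<in> alg_on G \<Longrightarrow> x \<approx>\<^bsub>G\<^esub> x"
  by (simp add: leavitt_eq_def leavitt_ideal.zero)

lemma leavitt_eq_sym: "x \<approx>\<^bsub>G\<^esub> y \<Longrightarrow> y \<approx>\<^bsub>G\<^esub> x"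
  using leavitt_ideal_minus[of "x - y" G] by (auto simp: leavitt_eq_def)

lemma leavitt_eq_trans [trans]: "x \<approx>\<^bsub>G\<^esub> y \<Longrightarrow> y \<approx>\<^bsub>G\<^esub> z \<Longrightarrow> x \<approx>\<^bsub>G\<^esub> z"
  using leavitt_ideal.add[of "x - y" G "y - z"] by (auto simp: leavitt_eq_def)

lemma leavitt_eq_add:
  assumes "x \<approx>\<^bsub>G\<^esub> x'" "y \<approx>\<^bsub>G\<^esub> y'"
  shows "x + y \<approx>\<^bsub>G\<^esub> x' + y'"
  using assms leavitt_ideal.add[of "x - x'" G "y - y'"] by (auto simp: leavitt_eq_def algebra_simps)

lemma leavitt_eq_smul: "x \<approx>\<^bsub>G\<^esub> y \<Longrightarrow> smul c x \<approx>\<^bsub>G\<^esub> smul c y"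
  using leavitt_ideal.smul[of "x - y" G c] by (auto simp: leavitt_eq_def smul_diff)

lemma leavitt_eq_minus: "x \<approx>\<^bsub>G\<^esub> y \<Longrightarrow> - x \<approx>\<^bsub>G\<^esub> - y"
  using leavitt_eq_smul[of x G y "-1"] by (simp add: smul_minus_one)

lemma leavitt_eq_diff: "x \<approx>\<^bsub>G\<^esub> x' \<Longrightarrow> y \<approx>\<^bsub>G\<^esub> y' \<Longrightarrow> x - y \<approx>\<^bsub>G\<^esub> x' - y'"
  using leavitt_eq_add[OF _ leavitt_eq_minus] by fastforce

lemma leavitt_eq_sum: "(\<And>i. i \<in> I \<Longrightarrow> f i \<approx>\<^bsub>G\<^esub> g i) \<Longrightarrow> sum f I \<approx>\<^bsub>G\<^esub> sum g I"
  by (induction I rule: infinite_finite_induct) (auto intro: leavitt_eq_add leavitt_eq_refl)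

lemma leavitt_eq_mult:
  assumes "x \<approx>\<^bsub>G\<^esub> x'" "y \<approx>\<^bsub>G\<^esub> y'"
  shows "x * y \<approx>\<^bsub>G\<^esub> x' * y'"
proof -
  have "x * y - x' * y' = x * (y - y') + (x - x') * y'" by (simp add: algebra_simps)
  then show ?thesis using assms
    by (auto simp: leavitt_eq_def alg_on_mult_leavitt_ideal intro: leavitt_ideal.add)
qed

lemma leavitt_eq_mult_left: "z \<in> alg_on G \<Longrightarrow> x \<approx>\<^bsub>G\<^esub> y \<Longrightarrow> z * x \<approx>\<^bsub>G\<^esub> z * y"
  by (simp add: leavitt_eq_mult leavitt_eq_refl)

lemma leavitt_eq_mult_right: "x \<approx>\<^bsub>G\<^esub> y \<Longrightarrow> z \<in> alg_on G \<Longrightarrow> x * z \<approx>\<^bsub>G\<^esub> y * z"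
  by (simp add: leavitt_eq_mult leavitt_eq_refl)

lemma leavitt_eq_0_iff: "x \<approx>\<^bsub>G\<^esub> 0 \<longleftrightarrow> x \<in> alg_on G \<and> x \<in> leavitt_ideal G"
  by (simp add: leavitt_eq_def)

lemma leavitt_eqI: "x - y \<in> leavitt_relations G \<Longrightarrow> x \<in> alg_on G \<Longrightarrow> y \<in> alg_on G \<Longrightarrow> x \<approx>\<^bsub>G\<^esub> y"
  by (simp add: leavitt_eq_def leavitt_ideal.relation)

section \<open>The generators of the Leavitt path algebra\<close>

lemma gen_verts_Int: "A \<in> gen_verts G \<Longrightarrow> B \<in> gen_verts G \<Longrightarrow> A \<inter> B \<in> gen_verts G"
  using gen_verts.Inter[of "{A, B}" G] by simp

lemma gen_verts_Un: "A \<in> gen_verts G \<Longrightarrow> B \<in> gen_verts G \<Longrightarrow> A \<union> B \<in> gen_verts G"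
  using gen_verts.Union[of "{A, B}" G] by simp

lemma gen_verts_empty: "{} \<in> gen_verts G"
  using gen_verts.Union[of "{}" G] by simp

lemma gen_verts_subset_verts:
  assumes "ultragraph G" "A \<in> gen_verts G"
  shows "A \<subseteq> verts G"
  using assms(2)
proof induction
  case (rng e)
  then show ?case using ultragraph.rng_verts[OF assms(1)] by simp
qed auto

lemma pv_empty: "pv {} \<approx>\<^bsub>G\<^esub> 0"
  by (intro leavitt_eqI) (auto intro: leavitt_relations.p_empty alg_on_gvar gen_verts_empty)

lemma pv_mult_pv:
  "A \<in> gen_verts G \<Longrightarrow> B \<in> gen_verts G \<Longrightarrow> pv A * pv B \<approx>\<^bsub>G\<^esub> pv (A \<inter> B)"
  by (intro leavitt_eqI) (auto intro: leavitt_relations.p_Int alg_on_gvar gen_verts_Int)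

lemma pv_Un:
  "A \<in> gen_verts G \<Longrightarrow> B \<in> gen_verts G \<Longrightarrow> pv (A \<union> B) \<approx>\<^bsub>G\<^esub> pv A + pv B - pv (A \<inter> B)"
  by (intro leavitt_eqI)
    (auto intro!: leavitt_relations.p_Un alg_on_gvar gen_verts_Int gen_verts_Un)

lemma gen_verts_src: "ultragraph G \<Longrightarrow> e \<in> edges G \<Longrightarrow> {src G e} \<in> gen_verts G"
  by (simp add: gen_verts.vert ultragraph.src_verts)

lemma pv_mult_sv:
  assumes "ultragraph G" "e \<in> edges G" "A \<in> gen_verts G"
  shows "pv A * sv e \<approx>\<^bsub>G\<^esub> (if src G e \<in> A then sv e else 0)"
proof -
  let ?v = "{src G e}"
  note [intro] = alg_on_gvar assms gen_verts_src[OF assms(1,2)] gen_verts_Int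
  have src: "pv ?v * sv e \<approx>\<^bsub>G\<^esub> sv e"
    by (intro leavitt_eqI leavitt_relations.src_s) auto
  have "pv A * sv e \<approx>\<^bsub>G\<^esub> pv A * (pv ?v * sv e)"
    by (intro leavitt_eq_mult_left leavitt_eq_sym[OF src]) auto
  also have "\<dots> = (pv A * pv ?v) * sv e" by (simp add: mult.assoc)
  also have "\<dots> \<approx>\<^bsub>G\<^esub> pv (A \<inter> ?v) * sv e"
    by (intro leavitt_eq_mult_right pv_mult_pv) auto
  also have "\<dots> \<approx>\<^bsub>G\<^esub> (if src G e \<in> A then sv e else 0)"
  proof (cases "src G e \<in> A")
    case False
    have "pv {} * sv e \<approx>\<^bsub>G\<^esub> 0 * sv e" by (intro leavitt_eq_mult_right pv_empty) auto
    then show ?thesis using False by simp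
  qed (use src in simp)
  finally show ?thesis .
qed

lemma sv'_mult_pv:
  assumes "ultragraph G" "e \<in> edges G" "A \<in> gen_verts G"
  shows "sv' e * pv A \<approx>\<^bsub>G\<^esub> (if src G e \<in> A then sv' e else 0)"
proof -
  let ?v = "{src G e}"
  note [intro] = alg_on_gvar assms gen_verts_src[OF assms(1,2)] gen_verts_Int
  have src: "sv' e * pv ?v \<approx>\<^bsub>G\<^esub> sv' e"
    by (intro leavitt_eqI leavitt_relations.s'_src) auto
  have "sv' e * pv A \<approx>\<^bsub>G\<^esub> (sv' e * pv ?v) * pv A"
    by (intro leavitt_eq_mult_right leavitt_eq_sym[OF src]) auto
  also have "\<dots> = sv' e * (pv ?v * pv A)" by (simp add: mult.assoc)
  also have "\<dots> \<approx>\<^bsub>G\<^esub> sv' e * pv (?v \<inter> A)"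
    by (intro leavitt_eq_mult_left pv_mult_pv) auto
  also have "\<dots> \<approx>\<^bsub>G\<^esub> (if src G e \<in> A then sv' e else 0)"
  proof (cases "src G e \<in> A")
    case False
    have "sv' e * pv {} \<approx>\<^bsub>G\<^esub> sv' e * 0" by (intro leavitt_eq_mult_left pv_empty) auto
    then show ?thesis using False by simp
  qed (use src in simp)
  finally show ?thesis .
qed

lemma sv_mult_rng: "e \<in> edges G \<Longrightarrow> sv e * pv (rng G e) \<approx>\<^bsub>G\<^esub> sv e"
  by (intro leavitt_eqI) (auto intro: leavitt_relations.s_rng alg_on_gvar gen_verts.rng)

lemma rng_mult_sv': "e \<in> edges G \<Longrightarrow> pv (rng G e) * sv' e \<approx>\<^bsub>G\<^esub> sv' e"
  by (intro leavitt_eqI) (auto intro: leavitt_relations.rng_s' alg_on_gvar gen_verts.rng)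

lemma sv'_mult_sv:
  "e \<in> edges G \<Longrightarrow> f \<in> edges G \<Longrightarrow> sv' e * sv f \<approx>\<^bsub>G\<^esub> (if e = f then pv (rng G e) else 0)"
  by (intro leavitt_eqI leavitt_relations.s's) (auto intro: alg_on_gvar gen_verts.rng)

lemma pv_regular:
  assumes "v \<in> verts G" "{e \<in> edges G. src G e = v} \<noteq> {}" "finite {e \<in> edges G. src G e = v}"
  shows "pv {v} \<approx>\<^bsub>G\<^esub> (\<Sum>e \<in> {e \<in> edges G. src G e = v}. sv e * sv' e)"
proof (rule leavitt_eqI)
  show "pv {v} - (\<Sum>e \<in> {e \<in> edges G. src G e = v}. sv e * sv' e) \<in> leavitt_relations G"
    by (rule leavitt_relations.p_sum) (use assms in \<open>auto simp: fun_eq_iff\<close>)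
qed (auto intro!: alg_on_gvar gen_verts.vert assms(1))

section \<open>Linear relations between the vertex idempotents\<close>

text \<open>The idempotent of the set difference \<open>B - C\<close>. Generalized vertices are closed under unions and
intersections but not under differences, so this element has to be written with \<open>p\<^sub>B\<close> and
\<open>p\<close> of the intersection.\<close>

definition pv_diff :: "'v set \<Rightarrow> 'v set \<Rightarrow> ('v, 'e, 'r::comm_ring_1) free_alg" where
  "pv_diff B C = pv B - pv (B \<inter> C)"

lemma alg_on_pv_diff: "B \<in> gen_verts G \<Longrightarrow> C \<in> gen_verts G \<Longrightarrow> pv_diff B C \<in> alg_on G"
  by (auto simp: pv_diff_def intro: alg_on_gvar gen_verts_Int)

lemma pv_mult_pv_diff:
  assumes "A \<in> gen_verts G" "B \<in> gen_verts G" "C \<in> gen_verts G"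
  shows "pv A * pv_diff B C \<approx>\<^bsub>G\<^esub> pv_diff (B \<inter> A) C"
proof -
  have "pv A * pv B - pv A * pv (B \<inter> C) \<approx>\<^bsub>G\<^esub> pv (A \<inter> B) - pv (A \<inter> (B \<inter> C))"
    using assms by (intro leavitt_eq_diff pv_mult_pv gen_verts_Int)
  then show ?thesis by (simp add: pv_diff_def right_diff_distrib Int_ac)
qed

text \<open>The partition of \<open>B - C\<close> into its parts inside and outside \<open>A\<close>, read as an equation of
idempotents. It is the relation for \<open>p\<close> of a union.\<close>

lemma pv_diff_split:
  assumes "A \<in> gen_verts G" "B \<in> gen_verts G" "C \<in> gen_verts G"
  shows "pv_diff B C \<approx>\<^bsub>G\<^esub> pv_diff (B \<inter> A) C + pv_diff B (C \<union> A)"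
proof -
  have "pv ((B \<inter> C) \<union> (B \<inter> A)) \<approx>\<^bsub>G\<^esub> pv (B \<inter> C) + pv (B \<inter> A) - pv ((B \<inter> C) \<inter> (B \<inter> A))"
    using assms by (intro pv_Un gen_verts_Int)
  moreover have "(B \<inter> C) \<inter> (B \<inter> A) = B \<inter> A \<inter> C" "(B \<inter> C) \<union> (B \<inter> A) = B \<inter> (C \<union> A)" by auto
  ultimately have "pv (B \<inter> (C \<union> A)) \<approx>\<^bsub>G\<^esub> pv (B \<inter> C) + pv (B \<inter> A) - pv (B \<inter> A \<inter> C)"
    by simp
  then have "pv_diff (B \<inter> A) C + (pv B - (pv (B \<inter> C) + pv (B \<inter> A) - pv (B \<inter> A \<inter> C))) \<approx>\<^bsub>G\<^esub>
      pv_diff (B \<inter> A) C + (pv B - pv (B \<inter> (C \<union> A)))"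
    using assms
    by (intro leavitt_eq_add leavitt_eq_diff leavitt_eq_refl alg_on_gvar alg_on_pv_diff gen_verts_Int)
      (auto intro: leavitt_eq_sym)
  then show ?thesis by (simp add: pv_diff_def algebra_simps)
qed

text \<open>The induction adds one set \<open>A\<^sub>i\<close> at a time and cuts \<open>B - C\<close> along it. On each of the two parts the
indicator of \<open>A\<^sub>i\<close> is constant, hence so is the sum over the remaining sets, and the induction
hypothesis applies. This is why the claim is about set differences and not only about generalized
vertices. The sets are given by an index, so that the same set may occur several times.\<close>

lemma sum_pv_constant:
  fixes G :: "('v, 'e) ultragraph_data" and z :: "'j \<Rightarrow> 'r::comm_ring_1"
  assumes "finite J" "A ` J \<subseteq> gen_verts G" "B \<in> gen_verts G" "C \<in> gen_verts G"
    and "\<And>v. v \<in> B \<Longrightarrow> v \<notin> C \<Longrightarrow> (\<Sum>j\<in>J. if v \<in> A j then z j else 0) = c"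
  shows "(\<Sum>j\<in>J. smul (z j) (pv (A j))) * pv_diff B C \<approx>\<^bsub>G\<^esub> smul c (pv_diff B C)"
  using assms
proof (induction J arbitrary: B C c rule: finite_induct)
  case empty
  show ?case
  proof (cases "B \<subseteq> C")
    case True
    then have "pv_diff B C = (0 :: ('v, 'e, 'r) free_alg)" by (simp add: pv_diff_def Int_absorb2)
    then show ?thesis by (simp add: leavitt_eq_refl)
  next
    case False
    then have "c = 0" using empty.prems by auto
    then show ?thesis by (simp add: leavitt_eq_refl)
  qed
next
  case (insert i J)
  let ?H = "\<Sum>j\<in>J. smul (z j) (pv (A j))" and ?A = "A i"
  have gv: "?A \<in> gen_verts G" "A ` J \<subseteq> gen_verts G" "B \<in> gen_verts G" "C \<in> gen_verts G"
    using insert.prems by auto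
  have val: "(if v \<in> ?A then z i else 0) + (\<Sum>j\<in>J. if v \<in> A j then z j else 0) = c"
    if "v \<in> B" "v \<notin> C" for v
    using insert.prems(4)[OF that] insert.hyps by simp
  have H: "?H \<in> alg_on G" using gv by (intro alg_on_sum alg_on_smul alg_on_gvar) auto
  have inside: "?H * pv_diff (B \<inter> ?A) C \<approx>\<^bsub>G\<^esub> smul (c - z i) (pv_diff (B \<inter> ?A) C)"
    by (intro insert.IH gv gen_verts_Int) (use val in \<open>force simp: algebra_simps\<close>)
  have outside: "?H * pv_diff B (C \<union> ?A) \<approx>\<^bsub>G\<^esub> smul c (pv_diff B (C \<union> ?A))"
    by (intro insert.IH gv gen_verts_Un) (use val in force)
  have "(\<Sum>j\<in>insert i J. smul (z j) (pv (A j))) * pv_diff B C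
      = smul (z i) (pv ?A * pv_diff B C) + ?H * pv_diff B C"
    using insert.hyps by (simp add: distrib_right smul_mult_left)
  also have "\<dots> \<approx>\<^bsub>G\<^esub> smul (z i) (pv_diff (B \<inter> ?A) C)
      + ?H * (pv_diff (B \<inter> ?A) C + pv_diff B (C \<union> ?A))"
    by (intro leavitt_eq_add leavitt_eq_smul leavitt_eq_mult_left pv_mult_pv_diff pv_diff_split gv H)
  also have "\<dots> \<approx>\<^bsub>G\<^esub> smul (z i) (pv_diff (B \<inter> ?A) C)
      + (smul (c - z i) (pv_diff (B \<inter> ?A) C) + smul c (pv_diff B (C \<union> ?A)))"
    unfolding distrib_left
    by (intro leavitt_eq_add inside outside leavitt_eq_refl alg_on_smul alg_on_pv_diff gv gen_verts_Int)
  also have "\<dots> = smul c (pv_diff (B \<inter> ?A) C + pv_diff B (C \<union> ?A))"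
    by (simp add: smul_add flip: add.assoc smul_add_left)
  also have "\<dots> \<approx>\<^bsub>G\<^esub> smul c (pv_diff B C)"
    by (intro leavitt_eq_smul leavitt_eq_sym[OF pv_diff_split] gv)
  finally show ?case .
qed

text \<open>A linear combination of vertex idempotents is thus determined by the function that it defines on
the vertices: all relations between the \<open>p\<^sub>A\<close> come from relations between indicator functions.\<close>

lemma sum_pv_eq_0:
  fixes G :: "('v, 'e) ultragraph_data" and z :: "'j \<Rightarrow> 'r::comm_ring_1"
  assumes fin: "finite J" and gv: "A ` J \<subseteq> gen_verts G"
    and zero: "\<And>v. (\<Sum>j\<in>J. if v \<in> A j then z j else 0) = 0"
  shows "(\<Sum>j\<in>J. smul (z j) (pv (A j))) \<approx>\<^bsub>G\<^esub> 0"
proof -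
  let ?B = "\<Union>(A ` J)" and ?H = "\<Sum>j\<in>J. smul (z j) (pv (A j))"
  have B: "?B \<in> gen_verts G" using fin gv by (intro gen_verts.Union) auto
  have "?H * pv_diff ?B {} \<approx>\<^bsub>G\<^esub> smul 0 (pv_diff ?B {})"
    by (rule sum_pv_constant) (use fin gv B gen_verts_empty zero in auto)
  then have *: "?H * pv_diff ?B {} \<approx>\<^bsub>G\<^esub> 0" by simp
  have "pv (A j) \<approx>\<^bsub>G\<^esub> pv (A j) * pv_diff ?B {}" if "j \<in> J" for j
  proof -
    have A: "A j \<in> gen_verts G" using that gv by auto
    have "pv (A j) \<approx>\<^bsub>G\<^esub> pv (A j) - 0" using A by (simp add: leavitt_eq_refl alg_on_gvar)
    also have "\<dots> \<approx>\<^bsub>G\<^esub> pv (A j) - pv {}"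
      using A by (intro leavitt_eq_diff leavitt_eq_sym[OF pv_empty] leavitt_eq_refl alg_on_gvar)
    also have "\<dots> = pv_diff (?B \<inter> A j) {}"
      using that by (simp add: pv_diff_def Int_absorb1 UN_upper)
    also have "\<dots> \<approx>\<^bsub>G\<^esub> pv (A j) * pv_diff ?B {}"
      by (intro leavitt_eq_sym[OF pv_mult_pv_diff] A B gen_verts_empty)
    finally show ?thesis .
  qed
  then have "?H \<approx>\<^bsub>G\<^esub> (\<Sum>j\<in>J. smul (z j) (pv (A j) * pv_diff ?B {}))"
    by (intro leavitt_eq_sum leavitt_eq_smul)
  also have "\<dots> = ?H * pv_diff ?B {}" by (simp add: sum_distrib_right smul_mult_left)
  also note *
  finally show ?thesis .
qed

text \<open>The difference of the two sides is a combination of vertex idempotents whose function is zero.\<close>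

lemma sum_pv_finite_support:
  fixes G :: "('v, 'e) ultragraph_data" and z :: "'j \<Rightarrow> 'r::comm_ring_1"
    and A :: "'j \<Rightarrow> 'v set" and J :: "'j set"
  defines "c \<equiv> \<lambda>v. \<Sum>j\<in>J. if v \<in> A j then z j else 0"
  assumes J: "finite J" "A ` J \<subseteq> gen_verts G" and V: "finite V" "V \<subseteq> verts G"
    and supp: "\<And>v. v \<notin> V \<Longrightarrow> c v = 0"
  shows "(\<Sum>j\<in>J. smul (z j) (pv (A j))) \<approx>\<^bsub>G\<^esub> (\<Sum>v\<in>V. smul (c v) (pv {v}))"
proof -
  let ?H = "\<Sum>j\<in>J. smul (z j) (pv (A j))" and ?V = "\<Sum>v\<in>V. smul (c v) (pv {v})"
  let ?A = "case_sum A (\<lambda>v. {v})" and ?z = "case_sum z (\<lambda>v. - c v)"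
  \<comment> \<open>\<open>Inl\<close> indexes the given sets and \<open>Inr\<close> the singletons to be subtracted.\<close>
  have "(\<Sum>j\<in>J <+> V. smul (?z j) (pv (?A j))) \<approx>\<^bsub>G\<^esub> 0"
  proof (rule sum_pv_eq_0)
    fix v
    have "(\<Sum>j\<in>J <+> V. if v \<in> ?A j then ?z j else 0) = c v + (\<Sum>u\<in>V. if u = v then - c v else 0)"
      using J(1) V(1) by (auto simp: sum.Plus c_def intro!: sum.cong)
    then show "(\<Sum>j\<in>J <+> V. if v \<in> ?A j then ?z j else 0) = 0"
      using V(1) supp by auto
  qed (use J V gen_verts.vert[of _ G] in auto)
  then have "?H - ?V \<approx>\<^bsub>G\<^esub> 0"
    using J(1) V(1) by (simp add: sum.Plus smul_minus_left sum_negf)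
  moreover have "?V \<in> alg_on G" using V by (intro alg_on_sum alg_on_smul alg_on_gvar gen_verts.vert) auto
  ultimately have "?H - ?V + ?V \<approx>\<^bsub>G\<^esub> 0 + ?V" by (intro leavitt_eq_add leavitt_eq_refl)
  then show ?thesis by simp
qed

section \<open>Expansion along the last ghost edge\<close>

definition spath :: "'e list \<Rightarrow> ('v, 'e, 'r::comm_ring_1) free_alg" where
  "spath a = Poly_Mapping.single (Word (map S a)) 1"

lemma spath_Nil [simp]: "spath [] = 1"
  by (simp add: spath_def flip: zero_word_def)

lemma spath_snoc: "spath (a @ [e]) = spath a * sv e"
  by (simp add: spath_def gvar_def mult_single plus_word_def)

lemma alg_on_spath: "set a \<subseteq> edges G \<Longrightarrow> spath a \<in> alg_on G"
  unfolding spath_def by (rule alg_on_single) (auto simp: gens_def)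

fun analytic_mono :: "'e list \<times> 'v set \<Rightarrow> ('v, 'e, 'r::comm_ring_1) free_alg" where
  "analytic_mono (a, A) = spath a * pv A"

text \<open>With these restrictions \<open>s\<^sub>a p\<^sub>A\<close> sends the basis
vector of every path \<open>q\<close> with source in \<open>A\<close> to that of \<open>a q\<close>.\<close>

definition analytic_index :: "('v, 'e) ultragraph_data \<Rightarrow> ('e list \<times> 'v set) set" where
  "analytic_index G =
     {(a, A). A \<in> gen_verts G \<and> (a = [] \<or> fin_path G a \<and> A \<subseteq> rng G (last a))}"

text \<open>The span of the monomials \<open>s\<^sub>a p\<^sub>A\<close>, up to congruence: the elements that can be written without
ghost edges \<open>s\<^sub>e\<^sup>*\<close>.\<close>

definition analytic :: "('v, 'e) ultragraph_data \<Rightarrow> ('v, 'e, 'r::comm_ring_1) free_alg set" where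
  "analytic G = {d. \<exists>z. Poly_Mapping.keys z \<subseteq> analytic_index G \<and> d \<approx>\<^bsub>G\<^esub> lin_ext analytic_mono z}"

lemma fin_path_snoc:
  assumes "a = [] \<or> fin_path G a \<and> src G e \<in> rng G (last a)" "e \<in> edges G"
  shows "fin_path G (a @ [e])"
  using assms by (induction a) (auto simp: fin_path_Cons hd_append split: if_splits)

lemma alg_on_analytic_mono: "k \<in> analytic_index G \<Longrightarrow> analytic_mono k \<in> alg_on G"
  by (cases k) (auto simp: analytic_index_def fin_path_def intro!: alg_on_mult alg_on_gvar alg_on_spath)

lemma analytic_alg_on: "d \<in> analytic G \<Longrightarrow> d \<in> alg_on G"
  by (auto simp: analytic_def leavitt_eq_def)

lemma analytic_cong: "x \<approx>\<^bsub>G\<^esub> y \<Longrightarrow> y \<in> analytic G \<Longrightarrow> x \<in> analytic G"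
  unfolding analytic_def using leavitt_eq_trans by blast

lemma analytic_mono_in: "k \<in> analytic_index G \<Longrightarrow> analytic_mono k \<in> analytic G"
  unfolding analytic_def
  by (auto intro!: exI[of _ "Poly_Mapping.single k 1"] leavitt_eq_refl alg_on_analytic_mono)

lemma analytic_zero: "0 \<in> analytic G"
  unfolding analytic_def by (auto intro!: exI[of _ 0] leavitt_eq_refl)

lemma analytic_add: "x \<in> analytic G \<Longrightarrow> y \<in> analytic G \<Longrightarrow> x + y \<in> analytic G"
proof -
  assume "x \<in> analytic G" "y \<in> analytic G"
  then obtain z z' where "Poly_Mapping.keys z \<subseteq> analytic_index G" "x \<approx>\<^bsub>G\<^esub> lin_ext analytic_mono z"
    "Poly_Mapping.keys z' \<subseteq> analytic_index G" "y \<approx>\<^bsub>G\<^esub> lin_ext analytic_mono z'"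
    unfolding analytic_def by auto
  then show ?thesis unfolding analytic_def using keys_add[of z z']
    by (auto intro!: exI[of _ "z + z'"] simp: lin_ext_add intro: leavitt_eq_add)
qed

lemma analytic_smul: "x \<in> analytic G \<Longrightarrow> smul c x \<in> analytic G"
proof -
  assume "x \<in> analytic G"
  then obtain z where "Poly_Mapping.keys z \<subseteq> analytic_index G" "x \<approx>\<^bsub>G\<^esub> lin_ext analytic_mono z"
    unfolding analytic_def by auto
  then show ?thesis unfolding analytic_def using keys_smul[of c z]
    by (auto intro!: exI[of _ "smul c z"] simp: lin_ext_smul intro: leavitt_eq_smul)
qed

lemma analytic_mult:
  assumes d: "d \<in> analytic G" and g: "g \<in> alg_on G"
    and mono: "\<And>k. k \<in> analytic_index G \<Longrightarrow> analytic_mono k * g \<in> analytic G"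
  shows "d * g \<in> analytic G"
proof -
  from d obtain z where z: "Poly_Mapping.keys z \<subseteq> analytic_index G" "d \<approx>\<^bsub>G\<^esub> lin_ext analytic_mono z"
    unfolding analytic_def by auto
  have "lin_ext analytic_mono z * g \<in> analytic G" using z(1)
  proof (induction z rule: poly_mapping_keys_induct)
    case (single k c)
    then show ?case by (simp add: smul_mult_left analytic_smul mono)
  qed (simp_all add: analytic_zero lin_ext_add distrib_right analytic_add)
  then show ?thesis using leavitt_eq_mult_right[OF z(2) g] analytic_cong by blast
qed

lemma analytic_mult_pv:
  assumes "d \<in> analytic G" "B \<in> gen_verts G"
  shows "d * pv B \<in> analytic G"
proof (rule analytic_mult[OF assms(1) alg_on_gvar(1)[OF assms(2)]])
  fix k :: "'b list \<times> 'a set" assume k: "k \<in> analytic_index G"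
  obtain a A where kA: "k = (a, A)" by force
  have A: "A \<in> gen_verts G" "set a \<subseteq> edges G" using k kA by (auto simp: analytic_index_def fin_path_def)
  have "analytic_mono k * pv B = spath a * (pv A * pv B)" by (simp add: kA mult.assoc)
  also have "\<dots> \<approx>\<^bsub>G\<^esub> spath a * pv (A \<inter> B)"
    by (intro leavitt_eq_mult_left pv_mult_pv alg_on_spath A assms)
  finally show "analytic_mono k * pv B \<in> analytic G"
    by (rule analytic_cong) (use analytic_mono_in[of "(a, A \<inter> B)" G] k kA assms in
        \<open>auto simp: analytic_index_def intro: gen_verts_Int\<close>)
qed

lemma analytic_mult_sv:
  assumes "ultragraph G" "d \<in> analytic G" "f \<in> edges G"
  shows "d * sv f \<in> analytic G"
proof (rule analytic_mult[OF assms(2) alg_on_gvar(2)[OF assms(3)]])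
  fix k :: "'b list \<times> 'a set" assume k: "k \<in> analytic_index G"
  obtain a A where kA: "k = (a, A)" by force
  have A: "A \<in> gen_verts G" "set a \<subseteq> edges G" using k kA by (auto simp: analytic_index_def fin_path_def)
  have *: "analytic_mono k * sv f = spath a * (pv A * sv f)" by (simp add: kA mult.assoc)
  also have "\<dots> \<approx>\<^bsub>G\<^esub> spath a * (if src G f \<in> A then sv f else 0)"
    by (intro leavitt_eq_mult_left pv_mult_sv alg_on_spath A assms)
  also have "\<dots> \<approx>\<^bsub>G\<^esub> spath a * (if src G f \<in> A then sv f * pv (rng G f) else 0)"
    using assms by (auto intro!: leavitt_eq_mult_left alg_on_spath A leavitt_eq_sym[OF sv_mult_rng] leavitt_eq_refl)
  also have "\<dots> = (if src G f \<in> A then analytic_mono (a @ [f], rng G f) else 0)"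
    by (simp add: spath_snoc mult.assoc)
  finally show "analytic_mono k * sv f \<in> analytic G"
  proof (rule analytic_cong)
    have "(a @ [f], rng G f) \<in> analytic_index G" if "src G f \<in> A"
      using k kA that assms fin_path_snoc[of a G f] by (auto simp: analytic_index_def gen_verts.rng)
    then show "(if src G f \<in> A then analytic_mono (a @ [f], rng G f) else 0) \<in> analytic G"
      using analytic_mono_in[of "(a @ [f], rng G f)" G]
      by (cases "src G f \<in> A") (simp_all only: if_True if_False analytic_zero simp_thms True_implies_equals)
  qed
qed

lemma pv_analytic: "A \<in> gen_verts G \<Longrightarrow> pv A \<in> analytic G"
  using analytic_mono_in[of "([], A)" G] by (simp add: analytic_index_def)

text \<open>Elements written by recursion on the last ghost edge, as \<open>d + (\<Sum>e\<in>F. y\<^sub>e s\<^sub>e\<^sup>*)\<close> with \<open>d\<close> free of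
ghost edges. The normalization \<open>y\<^sub>e p\<^sub>r\<^sub>(\<^sub>e\<^sub>) = y\<^sub>e\<close> makes the coefficient recoverable: multiplying by
\<open>s\<^sub>f\<close> on the right gives \<open>d s\<^sub>f + y\<^sub>f\<close>. The recursive form gives an induction on the ghost
part, and avoids the bookkeeping of a normal form in monomials \<open>s\<^sub>a p\<^sub>A s\<^sub>b\<^sup>*\<close>.\<close>

inductive_set star_expandable :: "('v, 'e) ultragraph_data \<Rightarrow> ('v, 'e, 'r::comm_ring_1) free_alg set"
  for G :: "('v, 'e) ultragraph_data" where
  expand: "\<lbrakk>d \<in> analytic G; finite F; F \<subseteq> edges G;
     \<forall>e\<in>F. y e \<in> star_expandable G \<and> y e * pv (rng G e) \<approx>\<^bsub>G\<^esub> y e;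
     x \<approx>\<^bsub>G\<^esub> d + (\<Sum>e\<in>F. y e * sv' e)\<rbrakk> \<Longrightarrow> x \<in> star_expandable G"

lemma star_expandable_cong: "x \<approx>\<^bsub>G\<^esub> y \<Longrightarrow> y \<in> star_expandable G \<Longrightarrow> x \<in> star_expandable G"
  by (erule star_expandable.cases) (blast intro: star_expandable.expand leavitt_eq_trans)

lemma star_expandable_alg_on: "x \<in> star_expandable G \<Longrightarrow> x \<in> alg_on G"
  by (auto elim: star_expandable.cases simp: leavitt_eq_def)

lemma analytic_star_expandable: "d \<in> analytic G \<Longrightarrow> d \<in> star_expandable G"
  by (rule star_expandable.expand[where F = "{}"]) (auto intro: leavitt_eq_refl analytic_alg_on)

text \<open>The edge sets of the two expansions differ in general, so the coefficients are first extended by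
zero to the union.\<close>

lemma star_expandable_add:
  assumes "x \<in> star_expandable G" "x' \<in> star_expandable G"
  shows "x + x' \<in> star_expandable G"
  using assms
proof (induction arbitrary: x')
  case (expand d F y x)
  from expand.prems show ?case
  proof cases
    case (expand d' F' y')
    note x' = this
    define Y where "Y e = (if e \<in> F then y e else 0) + (if e \<in> F' then y' e else 0)" for e
    have "(\<Sum>e\<in>F \<union> F'. Y e * sv' e) =
        (\<Sum>e\<in>F \<union> F'. if e \<in> F then y e * sv' e else 0) + (\<Sum>e\<in>F \<union> F'. if e \<in> F' then y' e * sv' e else 0)"
      by (auto simp: Y_def distrib_right simp flip: sum.distrib intro!: sum.cong)
    also have "\<dots> = (\<Sum>e\<in>F. y e * sv' e) + (\<Sum>e\<in>F'. y' e * sv' e)"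
      using expand.hyps(2) x' by (simp add: sum.If_cases Int_absorb1 Un_Int_distrib2)
    finally have Y: "(\<Sum>e\<in>F \<union> F'. Y e * sv' e) = \<dots>" .
    show ?thesis
    proof (rule star_expandable.expand[where y = Y and F = "F \<union> F'" and d = "d + d'"])
      show "\<forall>e\<in>F \<union> F'. Y e \<in> star_expandable G \<and> Y e * pv (rng G e) \<approx>\<^bsub>G\<^esub> Y e"
        using expand.IH x' by (auto simp: Y_def distrib_right intro: leavitt_eq_add)
      have "x + x' \<approx>\<^bsub>G\<^esub> (d + (\<Sum>e\<in>F. y e * sv' e)) + (d' + (\<Sum>e\<in>F'. y' e * sv' e))"
        using expand.hyps x' by (intro leavitt_eq_add)
      then show "x + x' \<approx>\<^bsub>G\<^esub> d + d' + (\<Sum>e\<in>F \<union> F'. Y e * sv' e)"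
        unfolding Y by (simp add: algebra_simps)
    qed (use expand.hyps x' analytic_add in auto)
  qed
qed

lemma star_expandable_smul:
  "x \<in> star_expandable G \<Longrightarrow> smul c x \<in> star_expandable G"
proof (induction rule: star_expandable.induct)
  case (expand d F y x)
  show ?case
  proof (rule star_expandable.expand[where y = "\<lambda>e. smul c (y e)" and F = F and d = "smul c d"])
    show "smul c x \<approx>\<^bsub>G\<^esub> smul c d + (\<Sum>e\<in>F. smul c (y e) * sv' e)"
      using leavitt_eq_smul[OF expand.hyps(4), of c] by (simp add: smul_add smul_sum smul_mult_left)
    show "\<forall>e\<in>F. smul c (y e) \<in> star_expandable G \<and> smul c (y e) * pv (rng G e) \<approx>\<^bsub>G\<^esub> smul c (y e)"
      unfolding smul_mult_left using expand.IH by (blast intro: leavitt_eq_smul)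
  qed (use expand.hyps in \<open>simp_all add: analytic_smul\<close>)
qed

lemma star_expandable_mult_pv:
  assumes G: "ultragraph G" and "x \<in> star_expandable G" and A: "A \<in> gen_verts G"
  shows "x * pv A \<in> star_expandable G"
  using assms(2)
proof cases
  case (expand d F y)
  let ?F = "{e \<in> F. src G e \<in> A}"
  have pA: "pv A \<in> alg_on G" using A by (rule alg_on_gvar)
  have y: "y e \<in> alg_on G" if "e \<in> F" for e using expand that by (auto simp: star_expandable_alg_on)
  have "x * pv A \<approx>\<^bsub>G\<^esub> (d + (\<Sum>e\<in>F. y e * sv' e)) * pv A"
    by (intro leavitt_eq_mult_right expand pA)
  also have "\<dots> = d * pv A + (\<Sum>e\<in>F. y e * (sv' e * pv A))"
    by (simp add: distrib_right sum_distrib_right mult.assoc)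
  also have "\<dots> \<approx>\<^bsub>G\<^esub> d * pv A + (\<Sum>e\<in>F. y e * (if src G e \<in> A then sv' e else 0))"
    using expand A G y by (intro leavitt_eq_add leavitt_eq_refl leavitt_eq_sum leavitt_eq_mult_left sv'_mult_pv)
      (auto intro: analytic_alg_on analytic_mult_pv)
  also have "(\<Sum>e\<in>F. y e * (if src G e \<in> A then sv' e else 0)) = (\<Sum>e\<in>?F. y e * sv' e)"
    using expand by (simp add: sum.inter_filter if_distrib cong: if_cong)
  finally show ?thesis
    by (rule star_expandable.expand[rotated -1]) (use expand A analytic_mult_pv in auto)
qed

lemma expansion_mult_sv:
  assumes f: "f \<in> edges G" and d: "d \<in> alg_on G" and F: "finite F" "F \<subseteq> edges G"
    and y: "\<forall>e\<in>F. y e * pv (rng G e) \<approx>\<^bsub>G\<^esub> y e"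
  shows "(d + (\<Sum>e\<in>F. y e * sv' e)) * sv f \<approx>\<^bsub>G\<^esub> d * sv f + (if f \<in> F then y f else 0)"
proof -
  have ya: "y e \<in> alg_on G" if "e \<in> F" for e using y that by (auto dest: leavitt_eq_alg_on)
  have "(d + (\<Sum>e\<in>F. y e * sv' e)) * sv f = d * sv f + (\<Sum>e\<in>F. y e * (sv' e * sv f))"
    by (simp add: distrib_right sum_distrib_right mult.assoc)
  also have "\<dots> \<approx>\<^bsub>G\<^esub> d * sv f + (\<Sum>e\<in>F. y e * (if e = f then pv (rng G e) else 0))"
    using F f d ya
    by (intro leavitt_eq_add leavitt_eq_refl leavitt_eq_sum leavitt_eq_mult_left sv'_mult_sv)
      (auto intro: alg_on_gvar)
  also have "(\<Sum>e\<in>F. y e * (if e = f then pv (rng G e) else 0)) = (if f \<in> F then y f * pv (rng G f) else 0)"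
    using F by (simp add: if_distrib cong: if_cong)
  also have "d * sv f + \<dots> \<approx>\<^bsub>G\<^esub> d * sv f + (if f \<in> F then y f else 0)"
    using y f d by (intro leavitt_eq_add leavitt_eq_refl) (auto intro: alg_on_gvar leavitt_eq_refl)
  finally show ?thesis .
qed

lemma star_expandable_mult_sv:
  assumes G: "ultragraph G" and "x \<in> star_expandable G" and f: "f \<in> edges G"
  shows "x * sv f \<in> star_expandable G"
  using assms(2)
proof cases
  case (expand d F y)
  have "x * sv f \<approx>\<^bsub>G\<^esub> (d + (\<Sum>e\<in>F. y e * sv' e)) * sv f"
    by (intro leavitt_eq_mult_right expand alg_on_gvar f)
  also have "\<dots> \<approx>\<^bsub>G\<^esub> d * sv f + (if f \<in> F then y f else 0)"
    using expand G f by (intro expansion_mult_sv) (auto intro: analytic_alg_on)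
  finally show ?thesis
  proof (rule star_expandable_cong)
    have "(if f \<in> F then y f else 0) \<in> star_expandable G"
      using expand(4) by (simp add: analytic_star_expandable analytic_zero)
    then show "d * sv f + (if f \<in> F then y f else 0) \<in> star_expandable G"
      by (rule star_expandable_add[rotated])
        (intro analytic_star_expandable analytic_mult_sv G expand(1) f)
  qed
qed

lemma star_expandable_mult_sv':
  assumes G: "ultragraph G" and x: "x \<in> star_expandable G" and f: "f \<in> edges G"
  shows "x * sv' f \<in> star_expandable G"
proof (rule star_expandable.expand[where F = "{f}" and d = 0 and y = "\<lambda>_. x * pv (rng G f)"])
  have xa: "x \<in> alg_on G" using x by (rule star_expandable_alg_on)
  have r: "rng G f \<in> gen_verts G" using f by (rule gen_verts.rng)
  have "x * (pv (rng G f) * pv (rng G f)) \<approx>\<^bsub>G\<^esub> x * pv (rng G f \<inter> rng G f)"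
    by (intro leavitt_eq_mult_left pv_mult_pv r xa)
  then show "\<forall>e\<in>{f}. x * pv (rng G f) \<in> star_expandable G \<and>
      x * pv (rng G f) * pv (rng G e) \<approx>\<^bsub>G\<^esub> x * pv (rng G f)"
    using star_expandable_mult_pv[OF G x r] by (simp add: mult.assoc)
  show "x * sv' f \<approx>\<^bsub>G\<^esub> 0 + (\<Sum>e\<in>{f}. x * pv (rng G f) * sv' e)"
    using leavitt_eq_mult_left[OF xa leavitt_eq_sym[OF rng_mult_sv'[OF f]]] by (simp add: mult.assoc)
qed (use f in \<open>auto simp: analytic_zero\<close>)

lemma star_expandable_mult_gvar:
  assumes "ultragraph G" "x \<in> star_expandable G" "g \<in> gens G"
  shows "x * gvar g \<in> star_expandable G"
  using assms star_expandable_mult_pv[of G x] star_expandable_mult_sv[of G x] star_expandable_mult_sv'[of G x]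
  by (auto simp: gens_def)

text \<open>Every expandable element stays expandable when multiplied by a generator on the right, so words
are handled by induction from the left end.\<close>

lemma free_on_star_expandable:
  fixes x :: "('v, 'e, 'r::comm_ring_1) free_alg"
  assumes G: "ultragraph G" and "x \<in> free_on G"
  shows "x \<in> star_expandable G"
proof -
  have gen: "(gvar g :: ('v, 'e, 'r) free_alg) \<in> star_expandable G" if g: "g \<in> gens G" for g
  proof -
    consider A where "g = P A" "A \<in> gen_verts G" | e where "g = S e" "e \<in> edges G"
      | e where "g = Sstar e" "e \<in> edges G"
      using g by (auto simp: gens_def)
    then show ?thesis
    proof cases
      case 1
      then show ?thesis by (simp add: analytic_star_expandable pv_analytic)
    next
      case 2
      then have "pv {src G e} * sv e \<in> (star_expandable G :: ('v, 'e, 'r) free_alg set)"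
        by (intro star_expandable_mult_sv analytic_star_expandable pv_analytic gen_verts_src G)
      moreover have "pv {src G e} * sv e \<approx>\<^bsub>G\<^esub> (sv e :: ('v, 'e, 'r) free_alg)"
        using pv_mult_sv[OF G 2(2) gen_verts_src[OF G 2(2)]] by simp
      ultimately show ?thesis unfolding 2(1) by (rule star_expandable_cong[OF leavitt_eq_sym, rotated])
    next
      case 3
      then have "pv (rng G e) * sv' e \<in> (star_expandable G :: ('v, 'e, 'r) free_alg set)"
        by (intro star_expandable_mult_sv' analytic_star_expandable pv_analytic gen_verts.rng G)
      then show ?thesis
        unfolding 3(1) by (rule star_expandable_cong[OF leavitt_eq_sym[OF rng_mult_sv'[OF 3(2)]]])
    qed
  qed
  have word: "Poly_Mapping.single (Word gs) 1 \<in> (star_expandable G :: ('v, 'e, 'r) free_alg set)"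
    if "gs \<noteq> []" "set gs \<subseteq> gens G" for gs
    using that
  proof (induction gs rule: rev_induct)
    case (snoc g gs)
    show ?case
    proof (cases "gs = []")
      case True
      then show ?thesis using gen[of g] snoc.prems by (simp add: gvar_def)
    next
      case False
      then have "Poly_Mapping.single (Word gs) 1 * gvar g \<in> (star_expandable G :: ('v, 'e, 'r) free_alg set)"
        using snoc G by (intro star_expandable_mult_gvar) auto
      then show ?thesis by (simp add: gvar_def mult_single plus_word_def)
    qed
  qed simp
  have "Poly_Mapping.keys x \<subseteq> {w. letters w \<noteq> [] \<and> set (letters w) \<subseteq> gens G}"
    using assms(2) by (auto simp: free_on_def)
  then show ?thesis
  proof (induction x rule: poly_mapping_keys_induct)
    case (single w c)
    then show ?case using star_expandable_smul[OF word[of "letters w"], of c] by (simp add: smul_single)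
  qed (simp_all add: star_expandable_add analytic_star_expandable analytic_zero)
qed

section \<open>Paths that do not repeat early\<close>

abbreviation path_append :: "'e list \<Rightarrow> ('v, 'e) upath \<Rightarrow> ('v, 'e) upath" where
  "path_append \<equiv> foldr path_cons"

lemma path_cons_inject: "path_cons e q = path_cons f q' \<longleftrightarrow> e = f \<and> q = q'"
proof (cases q; cases q')
  fix p p' assume q: "q = Inf p" "q' = Inf p'"
  have "p = p'" if "case_nat e p = case_nat f p'"
  proof
    fix n show "p n = p' n" using fun_cong[OF that, of "Suc n"] by simp
  qed
  moreover have "e = f" if "case_nat e p = case_nat f p'" using fun_cong[OF that, of 0] by simp
  ultimately show ?thesis using q by auto
qed auto

lemma path_append_inject:
  "length a = length b \<Longrightarrow> path_append a q = path_append b q' \<longleftrightarrow> a = b \<and> q = q'"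
  by (induction a b rule: list_induct2) (auto simp: path_cons_inject)

lemma path_append_Fin: "path_append c (Fin a v) = Fin (c @ a) v"
  by (induction c) auto

lemma path_append_Inf:
  "path_append c (Inf p) = Inf (\<lambda>n. if n < length c then c ! n else p (n - length c))"
  by (induction c) (auto simp: fun_eq_iff nth_Cons split: nat.splits)

lemma path_src_path_append: "path_src G (path_append c q) = (if c = [] then path_src G q else src G (hd c))"
  by (cases c) auto

lemma path_append_in_paths:
  assumes "fin_path G c" "q \<in> paths G" "path_src G q \<in> rng G (last c)"
  shows "path_append c q \<in> paths G"
  using assms(1,3)
proof (induction c)
  case (Cons e c)
  then show ?case using path_cons_in_paths[of e G q] path_cons_in_paths[of e G "path_append c q"] assms(2)
    by (cases "c = []") (auto simp: fin_path_Cons path_src_path_append)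
qed (simp add: fin_path_def)

lemma spath_act:
  assumes "a = [] \<or> fin_path G a"
  shows "free_act G (spath a) (Poly_Mapping.single q (1 :: 'r::comm_ring_1)) =
    (if a = [] \<or> path_src G q \<in> rng G (last a) then Poly_Mapping.single (path_append a q) 1 else 0)"
  using assms
proof (induction a)
  case Nil
  have "free_act G (Poly_Mapping.single 0 (1 :: 'r)) (Poly_Mapping.single q 1) = Poly_Mapping.single q 1"
    by (simp add: free_act_single zero_word_def del: single_one)
  then show ?case by simp
next
  case (Cons e a)
  have "(spath (e # a) :: ('b, 'a, 'r) free_alg) = sv e * spath a"
    by (simp add: spath_def gvar_def mult_single plus_word_def)
  then show ?case using Cons
    by (auto simp: free_act_mult free_act_gvar fin_path_Cons path_src_path_append)
qed

text \<open>A vertex at which no path starts emits an edge, since it is not a sink, and no path starts at any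
vertex in the range of that edge. Repeating this produces an infinite path after all.\<close>

lemma exists_path:
  assumes G: "ultragraph G" and v: "v \<in> verts G"
  shows "\<exists>q\<in>paths G. path_src G q = v"
proof (rule ccontr)
  assume none: "\<not> ?thesis"
  define W where "W = {v \<in> verts G. \<forall>q\<in>paths G. path_src G q \<noteq> v}"
  have step: "\<exists>e w. e \<in> edges G \<and> src G e = u \<and> w \<in> rng G e \<and> w \<in> W" if "u \<in> W" for u
  proof -
    have "u \<notin> sinks G" using that by (force simp: W_def paths_def)
    then obtain e where e: "e \<in> edges G" "src G e = u" using \<open>u \<in> W\<close> by (auto simp: W_def sinks_def)
    obtain w where w: "w \<in> rng G e" using ultragraph.rng_nonempty[OF G e(1)] by auto
    have "w \<in> W"
    proof (rule ccontr)
      assume "w \<notin> W"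
      then obtain q where "q \<in> paths G" "path_src G q = w"
        using ultragraph.rng_verts[OF G e(1)] w by (auto simp: W_def)
      then have "path_cons e q \<in> paths G" "path_src G (path_cons e q) = u"
        using path_cons_in_paths[of e G q] e w by auto
      then show False using that by (auto simp: W_def)
    qed
    then show ?thesis using e w by blast
  qed
  then obtain f g where fg: "\<And>u. u \<in> W \<Longrightarrow> f u \<in> edges G \<and> src G (f u) = u \<and> g u \<in> rng G (f u) \<and> g u \<in> W"
    by metis
  have "v \<in> W" using none v by (auto simp: W_def)
  then have W: "(g ^^ n) v \<in> W" for n by (induction n) (auto simp: fg)
  then have "inf_path G (\<lambda>n. f ((g ^^ n) v))" by (auto simp: inf_path_def fg)
  then have "Inf (\<lambda>n. f ((g ^^ n) v)) \<in> paths G" by (simp add: paths_Inf_iff)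
  moreover have "path_src G (Inf (\<lambda>n. f ((g ^^ n) v))) = v" using fg[OF \<open>v \<in> W\<close>] by simp
  ultimately show False using none by blast
qed

text \<open>For nonempty \<open>c\<close>, a path equals itself with \<open>c\<close> put in front if and only if it is infinite and has the form
\<open>c c c \<dots>\<close>, so the condition excludes periods of length at most \<open>M\<close>.\<close>

definition aperiodic_upto :: "nat \<Rightarrow> ('v, 'e) upath \<Rightarrow> bool" where
  "aperiodic_upto M q \<longleftrightarrow> (\<forall>c. c \<noteq> [] \<and> length c \<le> M \<longrightarrow> path_append c q \<noteq> q)"

lemma aperiodic_uptoD: "aperiodic_upto M q \<Longrightarrow> path_append c q = q \<Longrightarrow> length c \<le> M \<Longrightarrow> c = []"
  by (auto simp: aperiodic_upto_def)

text \<open>What aperiodicity is for: distinct short initial segments give distinct basis vectors. If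
\<open>b = a c\<close> and \<open>a q = b q\<close>, then \<open>q = c q\<close>.\<close>

lemma path_append_eqD:
  assumes q: "aperiodic_upto M q"
    and "length a \<le> M" "length b \<le> M" "path_append a q = path_append b q"
  shows "a = b"
proof -
  have le: "a = b" if len: "length a \<le> length b" "length b \<le> M"
    and eq: "path_append a q = path_append b q" for a b
  proof -
    let ?c = "drop (length a) b"
    have "path_append (take (length a) b @ ?c) q = path_append a q" using eq by simp
    then have "path_append a q = path_append (take (length a) b) (path_append ?c q)"
      by (simp only: foldr_append o_apply)
    then have "a = take (length a) b" "path_append ?c q = q"
      using len path_append_inject[of a "take (length a) b" q "path_append ?c q"] by simp_all
    moreover from this(2) have "?c = []" by (rule aperiodic_uptoD[OF q]) (use len in simp)
    ultimately show ?thesis by (metis append_Nil2 append_take_drop_id)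
  qed
  show ?thesis using le[of a b] le[of b a] assms by (cases "length a \<le> length b") auto
qed

lemma aperiodic_upto_path_cons:
  assumes "aperiodic_upto M q"
  shows "aperiodic_upto M (path_cons e q)"
  unfolding aperiodic_upto_def
proof (intro allI impI notI)
  fix c assume c: "c \<noteq> [] \<and> length c \<le> M" and eq: "path_append c (path_cons e q) = path_cons e q"
  then obtain f c' where "c = f # c'" by (cases c) auto
  then have "path_append (c' @ [e]) q = q" using eq by (simp add: path_cons_inject)
  from aperiodic_uptoD[OF assms this] show False using c \<open>c = f # c'\<close> by simp
qed

lemma aperiodic_upto_Fin: "aperiodic_upto M (Fin a v)"
  by (simp add: aperiodic_upto_def path_append_Fin)

lemma path_append_Inf_periodic:
  assumes "path_append c (Inf p) = Inf p"
  shows "p (n + m * length c) = p n" and "n < length c \<Longrightarrow> c ! n = p n"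
proof -
  have *: "p = (\<lambda>n. if n < length c then c ! n else p (n - length c))"
    using assms by (simp add: path_append_Inf)
  show "n < length c \<Longrightarrow> c ! n = p n" using fun_cong[OF *, of n] by simp
  have step: "p (n + length c) = p n" for n using fun_cong[OF *, of "n + length c"] by simp
  show "p (n + m * length c) = p n"
  proof (induction m)
    case (Suc m)
    have "n + Suc m * length c = (n + m * length c) + length c" by simp
    then show ?case using step[of "n + m * length c"] Suc by metis
  qed simp
qed

lemma fin_path_prefix:
  assumes "inf_path G p"
  shows "fin_path G (map p [0..<Suc n])"
  using assms unfolding fin_path_def inf_path_def by (auto simp del: upt_Suc)

text \<open>A path that ends in a sink is never periodic. If none starts at \<open>v\<close>, and some infinite path from
\<open>v\<close> is \<open>c c c \<dots>\<close> with \<open>c\<close> short, then Condition (L) provides an exit of \<open>c\<close>, which must be an edge \<open>e\<close>. Follow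
\<open>c\<close> for \<open>M\<close> rounds, leave through \<open>e\<close> and continue in any way. A period \<open>m \<le> M\<close> of the new path would
also make \<open>m |c|\<close> a period; going back \<open>m |c|\<close> steps from \<open>e\<close> leads into the part where the path
still runs around \<open>c\<close>, at the position where the edge differs from \<open>e\<close>.\<close>

lemma exists_aperiodic_path:
  fixes G :: "('v, 'e) ultragraph_data"
  assumes G: "ultragraph G" and L: "condition_L G" and v: "v \<in> verts G"
  shows "\<exists>q\<in>paths G. path_src G q = v \<and> aperiodic_upto M q"
proof (cases "\<exists>a w. Fin a w \<in> paths G \<and> path_src G (Fin a w) = v")
  case True
  then obtain a w where "Fin a w \<in> paths G" "path_src G (Fin a w) = v" by auto
  then show ?thesis using aperiodic_upto_Fin[of M a w] by (intro bexI[of _ "Fin a w"]) simp_all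
next
  case False
  obtain q where q: "q \<in> paths G" "path_src G q = v" using exists_path[OF G v] by blast
  then obtain p where qp: "q = Inf p" using False by (cases q) auto
  then have p: "inf_path G p" "src G (p 0) = v" using q by (auto simp: paths_Inf_iff)
  show ?thesis
  proof (cases "aperiodic_upto M q")
    case False
    then obtain c where c: "c \<noteq> []" "length c \<le> M" "path_append c (Inf p) = (Inf p :: ('v, 'e) upath)"
      by (auto simp: aperiodic_upto_def qp)
    let ?k = "length c"
    note per = path_append_Inf_periodic[OF c(3)]
    have k: "0 < ?k" using c by simp
    have cp: "c = map p [0..<?k]" by (rule nth_equalityI) (auto simp: per(2))
    have "fin_path G c" using fin_path_prefix[OF p(1), of "?k - 1"] k by (subst cp) (simp del: upt_Suc)
    moreover have "src G (hd c) \<in> rng G (last c)"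
    proof -
      have "src G (p (Suc (?k - 1))) \<in> rng G (p (?k - 1))" using p(1) by (simp add: inf_path_def)
      moreover have "p (Suc (?k - 1)) = p 0" using per(1)[of 0 1] k by simp
      ultimately show ?thesis using c(1) k per(2)[of 0] per(2)[of "?k - 1"]
        by (simp add: hd_conv_nth last_conv_nth)
    qed
    ultimately have "closed_path G c" by (simp add: closed_path_def)
    then consider (edge) e i where "e \<in> edges G" "i < ?k" "src G e \<in> rng G (c ! i)" "e \<noteq> c ! (Suc i mod ?k)"
      | (sink) w i where "w \<in> sinks G" "i < ?k" "w \<in> rng G (c ! i)"
      using L unfolding condition_L_def edge_exit_def sink_exit_def by blast
    then show ?thesis
    proof cases
      case sink
      then have "Fin (map p [0..<Suc i]) w \<in> paths G"
        using fin_path_prefix[OF p(1), of i] per(2)[of i] by (simp add: paths_Fin_iff)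
      moreover have "path_src G (Fin (map p [0..<Suc i]) w) = v"
        using p(2) by (simp add: upt_conv_Cons del: upt_Suc)
      ultimately show ?thesis using \<open>\<not> (\<exists>a w. Fin a w \<in> paths G \<and> path_src G (Fin a w) = v)\<close> by blast
    next
      case edge
      \<comment> \<open>The position of \<open>e\<close> in the new path; far enough for \<open>M |c|\<close> steps back.\<close>
      define t where "t = Suc i + M * ?k"
      have "c ! (Suc i mod ?k) = p (Suc i)"
      proof (cases "Suc i < ?k")
        case True
        then show ?thesis using per(2)[of "Suc i"] by simp
      next
        case False
        then have "Suc i = ?k" using edge(2) by simp
        then show ?thesis using per(2)[of 0] per(1)[of 0 1] k by simp
      qed
      then have et: "e \<noteq> p t" using edge(4) per(1)[of "Suc i" M] by (simp add: t_def)
      define b where "b = map p [0..<t]"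
      have b: "fin_path G b" using fin_path_prefix[OF p(1), of "t - 1"] by (simp add: b_def t_def)
      have "last b = p (i + M * ?k)" by (simp add: b_def t_def)
      then have "last b = c ! i" using per(1)[of i M] per(2)[OF edge(2)] by simp
      then have be: "fin_path G (b @ [e])"
        using b edge by (intro fin_path_snoc) auto
      obtain w where w: "w \<in> rng G e" using ultragraph.rng_nonempty[OF G edge(1)] by auto
      then obtain r where r: "r \<in> paths G" "path_src G r = w"
        using exists_path[OF G, of w] ultragraph.rng_verts[OF G edge(1)] by auto
      define q' where "q' = path_append (b @ [e]) r"
      have q'paths: "q' \<in> paths G"
        unfolding q'_def by (rule path_append_in_paths[OF be r(1)]) (use r w in simp)
      have q'src: "path_src G q' = v"
        unfolding q'_def path_src_path_append using p(2)
        by (simp add: b_def t_def hd_append upt_conv_Cons del: upt_Suc)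
      obtain p2 where "r = Inf p2"
      proof (cases r)
        case (Fin a u)
        then have "q' = Fin ((b @ [e]) @ a) u" unfolding q'_def by (simp only: path_append_Fin)
        then show ?thesis using q'paths q'src \<open>\<not> (\<exists>a w. Fin a w \<in> paths G \<and> path_src G (Fin a w) = v)\<close> by blast
      qed
      then obtain p' where q': "q' = Inf p'" "\<And>n. n \<le> t \<Longrightarrow> p' n = (b @ [e]) ! n"
        unfolding q'_def by (simp only: path_append_Inf) (auto simp: b_def)
      have p'lt: "p' n = p n" if "n < t" for n
        using q'(2)[of n] that by (simp add: b_def nth_append)
      have p't: "p' t = e" using q'(2)[of t] by (simp add: b_def nth_append)
      have "aperiodic_upto M q'"
        unfolding aperiodic_upto_def
      proof (intro allI impI notI)
        fix c' assume c': "c' \<noteq> [] \<and> length c' \<le> M" "path_append c' q' = q'"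
        let ?s = "t - ?k * length c'"
        have "length c' * ?k \<le> M * ?k" using c' by (intro mult_le_mono1) simp
        then have le: "?k * length c' \<le> t" unfolding t_def mult.commute[of ?k] by (rule trans_le_add2)
        have "?s < t" using k c' le by (cases "length c'") (auto simp: t_def)
        have "e = p' (?s + ?k * length c')" using p't le by simp
        also have "\<dots> = p' ?s" by (rule path_append_Inf_periodic) (use c'(2) q' in simp)
        also have "\<dots> = p ?s" using p'lt \<open>?s < t\<close> by simp
        also have "\<dots> = p (?s + length c' * ?k)" by (simp only: per(1))
        also have "\<dots> = p t" using le by (simp add: mult.commute)
        finally show False using et by simp
      qed
      then show ?thesis using q'paths q'src by blast
    qed
  qed (use q in blast)
qed

text \<open>An edge in front of an aperiodic path does not create a short period, so the first edge may be chosen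
freely, provided that some edge outside \<open>F\<close> starts at \<open>v\<close>.\<close>

lemma exists_aperiodic_path_avoiding:
  fixes G :: "('v, 'e) ultragraph_data"
  assumes G: "ultragraph G" and L: "condition_L G" and v: "v \<in> verts G"
    and F: "v \<in> sinks G \<or> (\<exists>e \<in> edges G - F. src G e = v)"
  obtains q where "q \<in> paths G" "path_src G q = v" "aperiodic_upto M q"
    "\<And>f. f \<in> F \<Longrightarrow> gen_act G (Sstar f) q = (0 :: ('v, 'e) upath \<Rightarrow>\<^sub>0 'r::comm_ring_1)"
  using F
proof
  assume "v \<in> sinks G"
  then show ?thesis using that[of "Fin [] v"] by (simp add: paths_Fin_iff aperiodic_upto_Fin)
next
  assume "\<exists>e \<in> edges G - F. src G e = v"
  then obtain e where e: "e \<in> edges G" "e \<notin> F" "src G e = v" by auto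
  obtain w where w: "w \<in> rng G e" using ultragraph.rng_nonempty[OF G e(1)] by auto
  then obtain r where "r \<in> paths G" "path_src G r = w" "aperiodic_upto M r"
    using exists_aperiodic_path[OF G L, of w M] ultragraph.rng_verts[OF G e(1)] by auto
  moreover from this have "path_cons e r \<in> paths G" using e(1) w by (simp add: path_cons_in_paths)
  moreover have "gen_act G (Sstar f) (path_cons e r) = (0 :: ('v, 'e) upath \<Rightarrow>\<^sub>0 'r)" if "f \<in> F" for f
    using that e(2) by auto
  ultimately show ?thesis
    using that[of "path_cons e r"] e(3) by (simp add: aperiodic_upto_path_cons)
qed

section \<open>Elements that act as zero\<close>

definition acts_zero :: "('v, 'e) ultragraph_data \<Rightarrow> ('v, 'e, 'r::comm_ring_1) free_alg \<Rightarrow> bool" where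
  "acts_zero G x \<longleftrightarrow> (\<forall>m\<in>path_module G. free_act G x m = 0)"

lemma acts_zero_cong:
  assumes "x \<approx>\<^bsub>G\<^esub> y" "acts_zero G x"
  shows "acts_zero G y"
  using leavitt_ideal_act[of "x - y" G] assms
  by (auto simp: acts_zero_def leavitt_eq_def free_act_diff)

lemma acts_zero_mult_sv:
  "acts_zero G x \<Longrightarrow> f \<in> edges G \<Longrightarrow> acts_zero G (x * sv f)"
  by (simp add: acts_zero_def free_act_mult free_act_in_path_module free_on_gvar gens_def)

lemma single_in_path_module: "q \<in> paths G \<Longrightarrow> Poly_Mapping.single q 1 \<in> path_module G"
  by (simp add: path_module_def)

lemma acts_zeroI:
  assumes "\<And>q. q \<in> paths G \<Longrightarrow> free_act G x (Poly_Mapping.single q 1) = 0"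
  shows "acts_zero G x"
  unfolding acts_zero_def
  by (auto intro!: lin_zero_on_path_module[of "free_act G x" G] assms
      simp: free_act_add_right free_act_smul_right)

lemma free_act_lin_ext: "free_act G (lin_ext f z) m = lin_ext (\<lambda>k. free_act G (f k) m) z"
  by (simp add: lin_ext_def free_act_sum free_act_smul)

text \<open>Right multiplication by this element restricts an operator on the path module to the paths whose
first edge is not in \<open>F\<close>.\<close>

definition off_edges :: "'e set \<Rightarrow> ('v, 'e, 'r::comm_ring_1) free_alg" where
  "off_edges F = 1 - (\<Sum>f\<in>F. sv f * sv' f)"

lemma alg_on_off_edges: "F \<subseteq> edges G \<Longrightarrow> off_edges F \<in> alg_on G"
  unfolding off_edges_def by (auto intro!: alg_on_gvar alg_on_diff alg_on_sum)

lemma free_act_one: "free_act G 1 (Poly_Mapping.single q 1) = Poly_Mapping.single q 1"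
  using spath_act[of "[]" G q] by simp

lemma off_edges_act:
  assumes "\<And>f. f \<in> F \<Longrightarrow> gen_act G (Sstar f) q = (0 :: ('v, 'e) upath \<Rightarrow>\<^sub>0 'r::comm_ring_1)"
  shows "free_act G (off_edges F) (Poly_Mapping.single q (1 :: 'r)) = Poly_Mapping.single q 1"
  using assms by (simp add: off_edges_def free_act_diff free_act_sum free_act_mult free_act_gvar free_act_one)

text \<open>At a vertex all of whose finitely many edges lie in \<open>F\<close>, this is the defining relation that expands
\<open>p\<^sub>v\<close> as a sum over the edges from \<open>v\<close>.\<close>

lemma pv_mult_off_edges:
  assumes G: "ultragraph G" and v: "v \<in> verts G" "v \<notin> sinks G"
    and F: "finite F" "F \<subseteq> edges G" "{e \<in> edges G. src G e = v} \<subseteq> F"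
  shows "pv {v} * off_edges F \<approx>\<^bsub>G\<^esub> 0"
proof -
  let ?E = "{e \<in> edges G. src G e = v}"
  have gv: "{v} \<in> gen_verts G" using v(1) by (rule gen_verts.vert)
  have E: "?E \<noteq> {}" "finite ?E" using v F finite_subset by (auto simp: sinks_def)
  have "pv {v} * off_edges F = pv {v} - (\<Sum>f\<in>F. (pv {v} * sv f) * sv' f)"
    by (simp add: off_edges_def right_diff_distrib sum_distrib_left mult.assoc)
  also have "\<dots> \<approx>\<^bsub>G\<^esub> (\<Sum>e\<in>?E. sv e * sv' e) - (\<Sum>f\<in>F. (if src G f \<in> {v} then sv f else 0) * sv' f)"
    using F(2) by (intro leavitt_eq_diff pv_regular E v leavitt_eq_sum leavitt_eq_mult_right pv_mult_sv G gv alg_on_gvar) auto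
  also have "(\<Sum>f\<in>F. (if src G f \<in> {v} then sv f else 0) * sv' f) = (\<Sum>f\<in>?E. sv f * sv' f)"
    using F by (intro sum.mono_neutral_cong_right) auto
  finally show ?thesis by simp
qed

text \<open>The sum is the value at \<open>v\<close> of the function with which \<open>s\<^sub>a\<close> occurs in the element. Applied to an
aperiodic path \<open>q\<close> from \<open>v\<close> that does not start in \<open>F\<close>, the element produces the vector \<open>a q\<close> with
precisely this coefficient, because no other initial segment that occurs leads to the same path.\<close>

lemma analytic_coefficient_zero:
  fixes G :: "('v, 'e) ultragraph_data" and z :: "('e list \<times> 'v set) \<Rightarrow>\<^sub>0 'r::comm_ring_1"
  assumes G: "ultragraph G" and L: "condition_L G"
    and z: "Poly_Mapping.keys z \<subseteq> analytic_index G"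
    and zero: "acts_zero G (lin_ext analytic_mono z * off_edges F)"
    and v: "v \<in> verts G" "v \<in> sinks G \<or> (\<exists>e \<in> edges G - F. src G e = v)"
  shows "(\<Sum>k\<in>{k \<in> Poly_Mapping.keys z. fst k = a}. if v \<in> snd k then Poly_Mapping.lookup z k else 0) = 0"
proof -
  let ?K = "Poly_Mapping.keys z"
  \<comment> \<open>A bound for all initial segments that are compared.\<close>
  define M where "M = Max (insert (length a) ((\<lambda>k. length (fst k)) ` ?K))"
  have M: "length a \<le> M" "length (fst k) \<le> M" if "k \<in> ?K" for k
    using that by (auto simp: M_def)
  have Ma: "length a \<le> M" by (simp add: M_def)
  obtain q where q: "q \<in> paths G" "path_src G q = v" "aperiodic_upto M q"
    "\<And>f. f \<in> F \<Longrightarrow> gen_act G (Sstar f) q = (0 :: ('v, 'e) upath \<Rightarrow>\<^sub>0 'r)"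
    using exists_aperiodic_path_avoiding[OF G L v] by blast
  have mono: "free_act G (analytic_mono k) (Poly_Mapping.single q (1::'r)) =
      (if v \<in> snd k then Poly_Mapping.single (path_append (fst k) q) 1 else 0)" if "k \<in> ?K" for k
  proof -
    have k: "fst k = [] \<or> fin_path G (fst k) \<and> snd k \<subseteq> rng G (last (fst k))"
      using subsetD[OF z that] by (cases k) (simp add: analytic_index_def)
    have "(analytic_mono k :: ('v, 'e, 'r) free_alg) = spath (fst k) * pv (snd k)"
      by (cases k) simp
    then show ?thesis using k q(2) spath_act[of "fst k" G q]
      by (auto simp: free_act_mult free_act_gvar)
  qed
  have "free_act G (off_edges F :: ('v, 'e, 'r) free_alg) (Poly_Mapping.single q 1) = Poly_Mapping.single q 1"
    by (rule off_edges_act) (rule q(4))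
  then have "0 = free_act G (lin_ext analytic_mono z) (Poly_Mapping.single q 1)"
    using zero single_in_path_module[OF q(1)] by (metis acts_zero_def free_act_mult)
  also have "\<dots> = (\<Sum>k\<in>?K. smul (Poly_Mapping.lookup z k)
      (if v \<in> snd k then Poly_Mapping.single (path_append (fst k) q) 1 else 0))"
    unfolding free_act_lin_ext by (simp add: lin_ext_def mono)
  finally have "0 = Poly_Mapping.lookup (\<Sum>k\<in>?K. smul (Poly_Mapping.lookup z k)
      (if v \<in> snd k then Poly_Mapping.single (path_append (fst k) q) 1 else 0)) (path_append a q)"
    by (metis lookup_zero)
  also have "\<dots> = (\<Sum>k\<in>?K. if fst k = a then if v \<in> snd k then Poly_Mapping.lookup z k else 0 else 0)"
    unfolding lookup_sum
  proof (rule sum.cong)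
    fix k assume k: "k \<in> ?K"
    have "path_append (fst k) q = path_append a q \<longleftrightarrow> fst k = a"
      using path_append_eqD[OF q(3) M(2)[OF k] Ma] by auto
    then show "Poly_Mapping.lookup (smul (Poly_Mapping.lookup z k)
        (if v \<in> snd k then Poly_Mapping.single (path_append (fst k) q) 1 else 0)) (path_append a q) =
        (if fst k = a then if v \<in> snd k then Poly_Mapping.lookup z k else 0 else 0)"
      by (simp add: lookup_single when_def)
  qed simp
  finally show ?thesis by (simp add: sum.inter_filter)
qed

text \<open>Collect the terms with the same \<open>a\<close>. Their coefficient function vanishes except at the finitely many
vertices \<open>v\<close> that emit edges, all of them in \<open>F\<close>. Hence it is a combination of such \<open>p\<^sub>v\<close>, and
these are killed by the factor on the right.\<close>

lemma analytic_off_edges_zero: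
  fixes G :: "('v, 'e) ultragraph_data"
  assumes G: "ultragraph G" and L: "condition_L G" and d: "d \<in> analytic G"
    and F: "finite F" "F \<subseteq> edges G"
    and zero: "acts_zero G (d * off_edges F :: ('v, 'e, 'r::comm_ring_1) free_alg)"
  shows "d * off_edges F \<approx>\<^bsub>G\<^esub> 0"
proof -
  let ?off = "off_edges F :: ('v, 'e, 'r) free_alg"
  have off: "?off \<in> alg_on G" using F(2) by (rule alg_on_off_edges)
  obtain z where z: "Poly_Mapping.keys z \<subseteq> analytic_index G" "d \<approx>\<^bsub>G\<^esub> lin_ext analytic_mono z"
    using d by (auto simp: analytic_def)
  let ?K = "Poly_Mapping.keys z"
  define J where "J a = {k \<in> ?K. fst k = a}" for a
  define g :: "'e list \<Rightarrow> ('v, 'e, 'r) free_alg"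
    where "g a = (\<Sum>k\<in>J a. smul (Poly_Mapping.lookup z k) (pv (snd k)))" for a
  define c where "c a v = (\<Sum>k\<in>J a. if v \<in> snd k then Poly_Mapping.lookup z k else 0)" for a v
  define V where "V = {v \<in> verts G. v \<notin> sinks G \<and> {e \<in> edges G. src G e = v} \<subseteq> F}"
  have eq: "d * ?off \<approx>\<^bsub>G\<^esub> lin_ext analytic_mono z * ?off"
    using z(2) off by (rule leavitt_eq_mult_right)
  have Jgv: "snd ` J a \<subseteq> gen_verts G" for a
    using z(1) by (auto simp: J_def analytic_index_def)
  have edges: "set (fst k) \<subseteq> edges G" if "k \<in> ?K" for k
    using subsetD[OF z(1) that] by (cases k) (auto simp: analytic_index_def fin_path_def)
  have Jfin: "finite (J a)" for a by (simp add: J_def)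
  have "V \<subseteq> src G ` F" by (force simp: V_def sinks_def)
  then have V: "finite V" "V \<subseteq> verts G" using F(1) finite_subset by (auto simp: V_def)
  have supp: "c a v = 0" if "v \<notin> V" for a v
  proof (cases "v \<in> verts G")
    case True
    then show ?thesis unfolding c_def J_def
      using that by (intro analytic_coefficient_zero[OF G L z(1) acts_zero_cong[OF eq zero]]) (auto simp: V_def)
  next
    case False
    then show ?thesis unfolding c_def
      using Jgv[of a] gen_verts_subset_verts[OF G] by (intro sum.neutral) fastforce
  qed
  have g0: "g a * ?off \<approx>\<^bsub>G\<^esub> 0" for a
  proof -
    have "g a \<approx>\<^bsub>G\<^esub> (\<Sum>v\<in>V. smul (c a v) (pv {v}))"
      unfolding g_def c_def by (rule sum_pv_finite_support) (use Jfin Jgv V supp in \<open>auto simp: c_def\<close>)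
    then have "g a * ?off \<approx>\<^bsub>G\<^esub> (\<Sum>v\<in>V. smul (c a v) (pv {v})) * ?off"
      using off by (rule leavitt_eq_mult_right)
    also have "\<dots> = (\<Sum>v\<in>V. smul (c a v) (pv {v} * ?off))"
      by (simp add: sum_distrib_right smul_mult_left)
    also have "\<dots> \<approx>\<^bsub>G\<^esub> (\<Sum>v\<in>V. smul (c a v) 0)"
      by (intro leavitt_eq_sum leavitt_eq_smul pv_mult_off_edges G F) (auto simp: V_def)
    finally show ?thesis by simp
  qed
  note eq
  also have "lin_ext analytic_mono z = (\<Sum>k\<in>?K. smul (Poly_Mapping.lookup z k) (spath (fst k) * pv (snd k)))"
    unfolding lin_ext_def by (intro sum.cong refl) (metis analytic_mono.simps prod.collapse)
  also have "\<dots> = (\<Sum>a\<in>fst ` ?K. \<Sum>k\<in>J a. smul (Poly_Mapping.lookup z k) (spath (fst k) * pv (snd k)))"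
    unfolding J_def by (rule sum.group[symmetric]) auto
  also have "\<dots> = (\<Sum>a\<in>fst ` ?K. spath a * g a)"
    by (auto simp: g_def J_def sum_distrib_left smul_mult_right intro!: sum.cong)
  also have "\<dots> * ?off = (\<Sum>a\<in>fst ` ?K. spath a * (g a * ?off))"
    by (simp add: sum_distrib_right mult.assoc)
  also have "\<dots> \<approx>\<^bsub>G\<^esub> (\<Sum>a\<in>fst ` ?K. spath a * 0)"
    by (intro leavitt_eq_sum leavitt_eq_mult_left g0 alg_on_spath)
      (use edges in auto)
  finally show ?thesis by simp
qed

text \<open>Write \<open>D\<close> for the part without ghost edges of \<open>d' + x = D + (\<Sum>f\<in>F. y\<^sub>f s\<^sub>f\<^sup>*)\<close>. Multiplication by \<open>s\<^sub>f\<close>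
leaves \<open>D s\<^sub>f + y\<^sub>f\<close>, which again acts as zero, so \<open>y\<^sub>f = - D s\<^sub>f\<close> by induction and the
element is \<open>D (1 - (\<Sum>f\<in>F. s\<^sub>f s\<^sub>f\<^sup>*))\<close>. The summand \<open>d'\<close> is there for the induction, where \<open>y\<^sub>f\<close>
comes with \<open>D s\<^sub>f\<close>.\<close>

lemma star_expandable_faithful:
  assumes G: "ultragraph G" and L: "condition_L G" and "x \<in> star_expandable G"
    and "d' \<in> analytic G" "acts_zero G (d' + x)"
  shows "d' + x \<approx>\<^bsub>G\<^esub> 0"
  using assms(3-)
proof (induction arbitrary: d')
  case (expand d F y x)
  let ?D = "d' + d" and ?z = "d' + d + (\<Sum>e\<in>F. y e * sv' e)"
  have D: "?D \<in> analytic G" using expand.hyps(1) expand.prems(1) by (simp add: analytic_add)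
  have z: "d' + x \<approx>\<^bsub>G\<^esub> ?z" unfolding add.assoc
    using expand.hyps expand.prems by (intro leavitt_eq_add leavitt_eq_refl analytic_alg_on)
  have z0: "acts_zero G ?z" using acts_zero_cong[OF z expand.prems(2)] .
  have y: "?D * sv f + y f \<approx>\<^bsub>G\<^esub> 0" if f: "f \<in> F" for f
  proof -
    have fe: "f \<in> edges G" using f expand.hyps by auto
    have "?z * sv f \<approx>\<^bsub>G\<^esub> ?D * sv f + (if f \<in> F then y f else 0)"
      by (rule expansion_mult_sv) (use expand.hyps expand.IH G fe D in \<open>auto intro: analytic_alg_on\<close>)
    then have "acts_zero G (?D * sv f + y f)"
      using acts_zero_cong acts_zero_mult_sv[OF z0 fe] f by fastforce
    moreover have "?D * sv f \<in> analytic G" using G D fe by (rule analytic_mult_sv)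
    ultimately show ?thesis using expand.IH f by blast
  qed
  have "?z = ?D * off_edges F + (\<Sum>f\<in>F. (?D * sv f + y f) * sv' f)"
    by (simp add: off_edges_def distrib_right distrib_left right_diff_distrib sum_distrib_left sum.distrib mult.assoc
        sum_distrib_right)
  also have "\<dots> \<approx>\<^bsub>G\<^esub> ?D * off_edges F + (\<Sum>f\<in>F. 0 * sv' f)"
    using expand.hyps D y
    by (intro leavitt_eq_add leavitt_eq_refl leavitt_eq_sum leavitt_eq_mult_right alg_on_mult)
      (auto intro: analytic_alg_on alg_on_off_edges alg_on_gvar)
  finally have off: "?z \<approx>\<^bsub>G\<^esub> ?D * off_edges F" by simp
  note z
  also note off
  also have "?D * off_edges F \<approx>\<^bsub>G\<^esub> 0"
    by (rule analytic_off_edges_zero[OF G L D expand.hyps(2,3) acts_zero_cong[OF off z0]])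
  finally show ?case .
qed

lemma faithful_if_condition_L:
  fixes G :: "('v, 'e) ultragraph_data"
  assumes "ultragraph G" "condition_L G" "x \<in> free_on G" "acts_zero G x"
  shows "x \<in> leavitt_ideal G"
  using star_expandable_faithful[OF assms(1,2) free_on_star_expandable[OF assms(1,3)] analytic_zero] assms(4)
  by (simp add: leavitt_eq_0_iff)

section \<open>The grading\<close>

primrec gen_deg :: "('v, 'e) gen \<Rightarrow> int" where
  "gen_deg (P A) = 0"
| "gen_deg (S e) = 1"
| "gen_deg (Sstar e) = -1"

definition word_deg :: "('v, 'e) gen word \<Rightarrow> int" where
  "word_deg w = (\<Sum>g\<leftarrow>letters w. gen_deg g)"

definition graded_part :: "int \<Rightarrow> ('v, 'e, 'r::comm_ring_1) free_alg \<Rightarrow> ('v, 'e, 'r) free_alg" where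
  "graded_part n = lin_ext (\<lambda>w. if word_deg w = n then Poly_Mapping.single w 1 else 0)"

lemma graded_part_single:
  "graded_part n (Poly_Mapping.single w c) = (if word_deg w = n then Poly_Mapping.single w c else 0)"
  by (simp add: graded_part_def smul_single)

lemma graded_part_add: "graded_part n (x + y) = graded_part n x + graded_part n y"
  by (simp add: graded_part_def lin_ext_add)

lemma graded_part_smul: "graded_part n (smul c x) = smul c (graded_part n x)"
  by (simp add: graded_part_def lin_ext_smul)

lemma graded_part_zero: "graded_part n 0 = 0"
  by (simp add: graded_part_def)

lemma word_deg_add: "word_deg (u + w) = word_deg u + word_deg w"
  by (simp add: word_deg_def plus_word_def)

lemma graded_part_single_mult:
  "graded_part n (Poly_Mapping.single w c * x) = Poly_Mapping.single w c * graded_part (n - word_deg w) x"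
  "graded_part n (x * Poly_Mapping.single w c) = graded_part (n - word_deg w) x * Poly_Mapping.single w c"
  by (induction x rule: poly_mapping_add_induct)
    (auto simp: graded_part_single graded_part_add mult_single distrib_left distrib_right word_deg_add)

definition homogeneous :: "int \<Rightarrow> ('v, 'e, 'r::comm_ring_1) free_alg \<Rightarrow> bool" where
  "homogeneous k x \<longleftrightarrow> (\<forall>n. graded_part n x = (if n = k then x else 0))"

lemma homogeneous_add: "homogeneous k x \<Longrightarrow> homogeneous k y \<Longrightarrow> homogeneous k (x + y)"
  by (simp add: homogeneous_def graded_part_add)

lemma homogeneous_zero: "homogeneous k 0"
  by (simp add: homogeneous_def graded_part_zero)

lemma homogeneous_smul: "homogeneous k x \<Longrightarrow> homogeneous k (smul c x)"
  by (simp add: homogeneous_def graded_part_smul)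

lemma homogeneous_diff: "homogeneous k x \<Longrightarrow> homogeneous k y \<Longrightarrow> homogeneous k (x - y)"
  using homogeneous_add[of k x "- y"] homogeneous_smul[of k y "-1"] by (simp add: smul_minus_one)

lemma homogeneous_sum: "(\<And>i. i \<in> I \<Longrightarrow> homogeneous k (f i)) \<Longrightarrow> homogeneous k (sum f I)"
  by (induction I rule: infinite_finite_induct) (auto intro: homogeneous_add homogeneous_zero)

lemma homogeneous_gvar: "k = gen_deg g \<Longrightarrow> homogeneous k (gvar g)"
  by (simp add: homogeneous_def gvar_def graded_part_single word_deg_def)

lemma homogeneous_gvar_mult: "k = gen_deg g + gen_deg h \<Longrightarrow> homogeneous k (gvar g * gvar h)"
  by (simp add: homogeneous_def gvar_def mult_single plus_word_def graded_part_single word_deg_def)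

lemma leavitt_relation_homogeneous:
  "x \<in> leavitt_relations G \<Longrightarrow> \<exists>k. homogeneous k x"
proof (induction rule: leavitt_relations.induct)
  case (src_s e)
  then show ?case by (intro exI[of _ 1] homogeneous_diff homogeneous_gvar homogeneous_gvar_mult) simp_all
next
  case (s_rng e)
  then show ?case by (intro exI[of _ 1] homogeneous_diff homogeneous_gvar homogeneous_gvar_mult) simp_all
next
  case (rng_s' e)
  then show ?case by (intro exI[of _ "-1"] homogeneous_diff homogeneous_gvar homogeneous_gvar_mult) simp_all
next
  case (s'_src e)
  then show ?case by (intro exI[of _ "-1"] homogeneous_diff homogeneous_gvar homogeneous_gvar_mult) simp_all
qed (intro exI[of _ 0], auto intro!: homogeneous_diff homogeneous_add homogeneous_sum
    homogeneous_gvar homogeneous_gvar_mult homogeneous_zero)+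

text \<open>The ideal is graded because it is generated by homogeneous elements.\<close>

lemma graded_part_leavitt_ideal:
  fixes x :: "('v, 'e, 'r::comm_ring_1) free_alg"
  assumes "x \<in> leavitt_ideal G"
  shows "graded_part n x \<in> leavitt_ideal G"
  using assms
proof (induction arbitrary: n)
  case (relation x)
  then obtain k where "homogeneous k x" using leavitt_relation_homogeneous by blast
  then show ?case using relation by (simp add: homogeneous_def leavitt_ideal.relation leavitt_ideal.zero)
next
  case (mult_left x y)
  from free_on_subset_alg_on[OF mult_left.hyps(2)] show ?case
    by (induction y rule: alg_on_induct)
      (simp_all add: graded_part_zero leavitt_ideal.zero graded_part_single_mult
        single_mult_leavitt_ideal mult_left.IH distrib_right graded_part_add leavitt_ideal.add)
next
  case (mult_right x y)
  from free_on_subset_alg_on[OF mult_right.hyps(2)] show ?case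
    by (induction y rule: alg_on_induct)
      (simp_all add: graded_part_zero leavitt_ideal.zero graded_part_single_mult
        single_mult_leavitt_ideal mult_right.IH distrib_left graded_part_add leavitt_ideal.add)
qed (simp_all add: graded_part_zero graded_part_add graded_part_smul leavitt_ideal.intros)

section \<open>Closed paths without exits\<close>

lemma no_exit_step:
  assumes no_exit: "\<nexists>e. edge_exit G a e" and "i < length a"
    and "e \<in> edges G" "src G e \<in> rng G (a ! i)"
  shows "e = a ! (Suc i mod length a)"
  using assms unfolding edge_exit_def by blast

text \<open>Without exits, a vertex in the range of an edge of \<open>a\<close> is not a sink, and the only edge that starts
there is the next edge of \<open>a\<close>. The path can only run around \<open>a\<close> forever.\<close>

lemma no_exit_path_unique:
  assumes no_exit: "\<nexists>e. edge_exit G a e" "\<nexists>w. sink_exit G a w"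
    and i: "i < length a" and q: "q \<in> paths G" "path_src G q \<in> rng G (a ! i)"
  shows "q = Inf (\<lambda>n. a ! ((Suc i + n) mod length a))"
proof -
  let ?k = "length a"
  note step = no_exit_step[OF no_exit(1)]
  \<comment> \<open>A path into a sink would have to reach the sink from the range of an edge of \<open>a\<close>.\<close>
  have Fin: False if "Fin b w \<in> paths G" "path_src G (Fin b w) \<in> rng G (a ! i)" "i < ?k" for b w i
    using that
  proof (induction b arbitrary: i)
    case Nil
    then show ?case using no_exit(2) by (auto simp: sink_exit_def paths_Fin_iff)
  next
    case (Cons e b)
    have e: "e \<in> edges G" using Cons.prems(1) by (auto simp: paths_Fin_iff fin_path_Cons)
    have "e = a ! (Suc i mod ?k)" by (rule step) (use Cons.prems e in auto)
    moreover have "Fin b w \<in> paths G" "path_src G (Fin b w) \<in> rng G e"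
      using Cons.prems(1) by (cases b; auto simp: paths_Fin_iff fin_path_Cons)+
    ultimately show ?case using Cons.IH[of "Suc i mod ?k"] Cons.prems(3) mod_less_divisor[of ?k] by fastforce
  qed
  obtain p where p: "q = Inf p" using Fin[of _ _ i] q i by (cases q) auto
  then have ip: "inf_path G p" using q by (simp add: paths_Inf_iff)
  have "p n = a ! ((Suc i + n) mod ?k)" for n
  proof (induction n)
    case 0
    show ?case using step[OF i, of "p 0"] ip q p by (simp add: inf_path_def)
  next
    case (Suc n)
    have "src G (p (Suc n)) \<in> rng G (a ! ((Suc i + n) mod ?k))"
      using ip unfolding inf_path_def Suc[symmetric] by blast
    moreover have "(Suc i + n) mod ?k < ?k" using i by (intro mod_less_divisor) linarith
    moreover have "p (Suc n) \<in> edges G" using ip by (simp add: inf_path_def)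
    ultimately have "p (Suc n) = a ! (Suc ((Suc i + n) mod ?k) mod ?k)" by (intro step)
    then show ?case by (simp add: mod_Suc_eq)
  qed
  then show ?thesis by (simp add: p fun_eq_iff)
qed

text \<open>Both elements kill the paths that do not start in the range of the last edge of \<open>a\<close>. Only one
path \<open>q\<close> starts there; since \<open>a q\<close> starts there as well, \<open>a q = q\<close>.\<close>

lemma closed_path_without_exit_acts_as_vertex:
  assumes a: "closed_path G a"
    and no_exit: "\<nexists>e. edge_exit G a e" "\<nexists>w. sink_exit G a w"
  shows "acts_zero G (spath a - pv {src G (hd a)})"
proof (rule acts_zeroI)
  fix q assume q: "q \<in> paths G"
  have fa: "fin_path G a" "a \<noteq> []" and closed: "src G (hd a) \<in> rng G (last a)"
    using a by (auto simp: closed_path_def fin_path_def)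
  have unique: "r = r'" if "r \<in> paths G" "path_src G r \<in> rng G (last a)"
    "r' \<in> paths G" "path_src G r' \<in> rng G (last a)" for r r'
    using no_exit_path_unique[OF no_exit, of "length a - 1" r]
      no_exit_path_unique[OF no_exit, of "length a - 1" r'] that fa(2)
    by (simp add: last_conv_nth)
  show "free_act G (spath a - pv {src G (hd a)}) (Poly_Mapping.single q 1) = 0"
  proof (cases "path_src G q \<in> rng G (last a)")
    case True
    have "path_append a q = q"
      by (rule unique) (use q fa closed True path_append_in_paths in \<open>auto simp: path_src_path_append\<close>)
    moreover from this have "path_src G q = src G (hd a)"
      using path_src_path_append[of G a q] fa(2) by simp
    ultimately show ?thesis using spath_act[of a G q] fa True by (simp add: free_act_diff free_act_gvar)
  next
    case False
    then show ?thesis using spath_act[of a G q] fa closed by (auto simp: free_act_diff free_act_gvar)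
  qed
qed

text \<open>The element has components in degrees \<open>|a| > 0\<close> and \<open>0\<close>. If it were in the ideal, so would be \<open>p\<^sub>v\<close>,
but \<open>p\<^sub>v\<close> fixes the basis vector of a path from \<open>v\<close>.\<close>

lemma spath_minus_pv_notin_ideal:
  fixes G :: "('v, 'e) ultragraph_data"
  assumes G: "ultragraph G" and v: "v \<in> verts G" and a: "a \<noteq> []"
  shows "spath a - pv {v} \<notin> (leavitt_ideal G :: ('v, 'e, 'r::comm_ring_1) free_alg set)"
proof
  assume "spath a - pv {v} \<in> (leavitt_ideal G :: ('v, 'e, 'r) free_alg set)"
  then have "graded_part 0 (spath a - pv {v}) \<in> (leavitt_ideal G :: ('v, 'e, 'r) free_alg set)"
    by (rule graded_part_leavitt_ideal)
  moreover have "word_deg (Word (map S a) :: ('v, 'e) gen word) = int (length a)"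
    by (induction a) (auto simp: word_deg_def)
  then have "graded_part 0 (spath a) = (0 :: ('v, 'e, 'r) free_alg)"
    using a by (simp add: spath_def graded_part_single)
  moreover have "graded_part 0 (- pv {v}) = (- pv {v} :: ('v, 'e, 'r) free_alg)"
    using homogeneous_smul[OF homogeneous_gvar[of 0 "P {v} :: ('v, 'e) gen"], of "-1 :: 'r"]
    by (simp add: smul_minus_one homogeneous_def)
  ultimately have "- pv {v} \<in> (leavitt_ideal G :: ('v, 'e, 'r) free_alg set)"
    using graded_part_add[of 0 "spath a" "- pv {v} :: ('v, 'e, 'r) free_alg"] by (metis add_0 diff_conv_add_uminus)
  then have pv: "pv {v} \<in> (leavitt_ideal G :: ('v, 'e, 'r) free_alg set)"
    using leavitt_ideal_minus by fastforce
  obtain q where "q \<in> paths G" "path_src G q = v" using exists_path[OF G v] by blast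
  then have "Poly_Mapping.single q (1 :: 'r) = 0"
    using leavitt_ideal_act[OF pv single_in_path_module[of q]] by (simp add: free_act_gvar)
  then show False by (metis lookup_single_eq lookup_zero zero_neq_one)
qed

section \<open>Faithfulness\<close>

lemma acts_zero_iff_restrict:
  "acts_zero G (x - y) \<longleftrightarrow> restrict (free_act G x) (path_module G) = restrict (free_act G y) (path_module G)"
  by (auto simp: acts_zero_def free_act_diff restrict_def fun_eq_iff)

lemma inj_on_path_rep_iff:
  fixes G :: "('v, 'e) ultragraph_data"
  shows "inj_on (path_rep G) (leavitt_algebra G :: ('v, 'e, 'r::comm_ring_1) free_alg set set) \<longleftrightarrow>
    (\<forall>x \<in> free_on G. \<forall>y \<in> free_on G.
      acts_zero G (x - y :: ('v, 'e, 'r) free_alg) \<longrightarrow> x - y \<in> leavitt_ideal G)"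
  unfolding leavitt_algebra_eq inj_on_def
  by (simp add: path_rep_class leavitt_class_eq_iff acts_zero_iff_restrict)

theorem theorem4p7:
  fixes G :: "('v, 'e) ultragraph_data"
  assumes "ultragraph G"
  shows "inj_on (path_rep G)
           (leavitt_algebra G :: ('v, 'e, 'r::comm_ring_1) free_alg set set)
         \<longleftrightarrow> condition_L G"
proof
  assume inj: "inj_on (path_rep G) (leavitt_algebra G :: ('v, 'e, 'r) free_alg set set)"
  show "condition_L G"
    unfolding condition_L_def
  proof (intro allI impI, rule ccontr)
    fix a assume a: "closed_path G a" and "\<not> ((\<exists>e. edge_exit G a e) \<or> (\<exists>w. sink_exit G a w))"
    then have "acts_zero G (spath a - pv {src G (hd a)} :: ('v, 'e, 'r) free_alg)"
      using closed_path_without_exit_acts_as_vertex[OF a] by blast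
    moreover have edges: "a \<noteq> []" "set a \<subseteq> edges G"
      using a by (auto simp: closed_path_def fin_path_def)
    then have v: "src G (hd a) \<in> verts G"
      using ultragraph.src_verts[OF assms] hd_in_set by blast
    have "(spath a :: ('v, 'e, 'r) free_alg) \<in> free_on G"
      using edges by (auto simp: spath_def free_on_def gens_def)
    moreover have "(pv {src G (hd a)} :: ('v, 'e, 'r) free_alg) \<in> free_on G"
      using v by (intro free_on_gvar) (simp add: gens_def gen_verts.vert)
    ultimately have "spath a - pv {src G (hd a)} \<in> (leavitt_ideal G :: ('v, 'e, 'r) free_alg set)"
      using inj unfolding inj_on_path_rep_iff by blast
    then show False using spath_minus_pv_notin_ideal[OF assms v edges(1)] by blast
  qed
next
  assume L: "condition_L G"
  have "x - y \<in> leavitt_ideal G" if "x \<in> free_on G" "y \<in> free_on G" "acts_zero G (x - y)"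
    for x y :: "('v, 'e, 'r) free_alg"
  proof (rule faithful_if_condition_L[OF assms L _ that(3)])
    show "x - y \<in> free_on G"
      using free_on_add[OF that(1) free_on_smul[OF that(2), of "-1"]] by (simp add: smul_minus_one)
  qed
  then show "inj_on (path_rep G) (leavitt_algebra G :: ('v, 'e, 'r) free_alg set set)"
    unfolding inj_on_path_rep_iff by blast
qed

end
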